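(* Finiteness of the range of a residually defined $g$-function of a property $(D)$ subshift is an invariant of topological conjugacy. That is: let $X\subset\Sigma^{\mathbb Z}$ and $\widetilde X\subset\widetilde\Sigma^{\mathbb Z}$ be property $(D)$ subshifts, $g$ a residually defined $g$-function of $X$, $\widetilde g$ a residually defined $g$-function of $\widetilde X$, and suppose that $\widetilde g$ is the image of $g$ under a topological conjugacy $\varphi:X\to\widetilde X$. Then the range of $g$ is finite if and only if the range of $\widetilde g$ is finite.
   Context: Subshifts. $\Sigma,\widetilde\Sigma$ are finite alphabets, $S$ is the shift, $(Sx)_i=x_{i+1}$. A subshift is a closed $S$-invariant set $X\subset\Sigma^{\mathbb Z}$; a finite word is admissible if it appears in some point of $X$. For an interval $J\subset\mathbb Z$, $x_J=(x_j)_{j\in J}$ and $X_J=\{x_J:x\in X\}$ with the product topology; blocks are identified with words up to translation of indices. A topological conjugacy is a shift-commuting homeomorphism. A set is residual if it contains a dense $G_\delta$. For $x^-\in X_{(-\infty,i]}$, $\Gamma_n^+(x^-)$ is the set of words $b$ of length $n$ with $(x^-,b)\in X_{(-\infty,i+n]}$. For an admissible word $a$, $\Gamma^-(a)$ is the set of finite words $c$ with $ca$ admissible, $\Gamma_\infty^-(a)$ is the set of left-infinite sequences $x^-$ such that $(x^-,a)$ is, up to translation, in $X_{(-\infty,0]}$, and $\omega_n^+(a)$ is the set of words $b$ of length $n$ such that $(x^-,a,b)$ is, up to translation, in $X_{(-\infty,0]}$ for all $x^-\in\Gamma_\infty^-(a)$. Property $(D)$: for every admissible word $b\sigma$ ($\sigma\in\Sigma$)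 there is $a\in\Gamma^-(b)$ with $\sigma\in\omega_1^+(ab)$. Residually defined $g$-function of $X$: a continuous function $g:D^-(g)\times\Sigma\to[0,1]$, $D^-(g)$ residual in $X_{(-\infty,0]}$, such that (i) $\sum_{\sigma\in\Gamma_1^+(x^-)}g(x^-,\sigma)=1$ for $x^-\in D^-(g)$, and $g(x^-,\sigma)=0$ if $\sigma\notin\Gamma_1^+(x^-)$; (ii) there is no point of $X_{(-\infty,0]}\setminus D^-(g)$ to which $x^-\mapsto(g(x^-,\sigma))_{\sigma\in\Sigma}$ can be extended by continuity; (iii) $X_{(-\infty,1]}=\overline{\{(x^-,\alpha):x^-\in D^-(g),\alpha\in\Gamma_1^+(x^-),g(x^-,\alpha)>0\}}$. By translation, $g(x^-,\alpha)$ is also used for $x^-\in S^{-i}D^-(g)\subset X_{(-\infty,i]}$. The set $E(g)$: the set of $x\in X$ such that for all $i\in\mathbb Z$: $x_{(-\infty,i]}\in S^{-i}D^-(g)$, $g(x_{(-\infty,i]},x_{i+1})>0$, and for all $k\in\mathbb N$ and all $a\in\Gamma_k^+(x_{(-\infty,i]})$, $(x_{(-\infty,i]},a)\in S^{-i-k}D^-(g)$. Measures. For $x\in E(g)$, $i\in\mathbb Z$: $F_i(x)=\{y\in X:y_{(-\infty,i]}=x_{(-\infty,i]}\}$, $F_i(x,a)=\{y\in F_i(x):y_{(i,i+n]}=a\}$, and $\mu_i^{(g)}(x_{(-\infty,i]})$ is the Borel probability measure on $F_i(x)$ with $$\mu_i^{(g)}(x_{(-\infty,i]})(F_i(x,a))=\prod_{1\le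 k\le N}g\big((x_{(-\infty,i]},a_1\cdots a_{k-1}),a_k\big)$$ for $a=a_1\cdots a_N\in\Gamma_N^+(x_{(-\infty,i]})$, $N\in\mathbb N$. There is a $\sigma$-finite measure $\lambda_x^{(g)}$ on $\bigcup_{k\in\mathbb N}F_{-k}(x)$, unique up to multiplication by a positive constant, such that for all $i\in\mathbb Z$: $0<\lambda_x^{(g)}(F_i(x))<\infty$ and $\lambda_x^{(g)}|_{F_i(x)}/\lambda_x^{(g)}(F_i(x))=\mu_i^{(g)}(x_{(-\infty,i]})$. Image. $\widetilde g$ is the image of $g$ under the topological conjugacy $\varphi:X\to\widetilde X$ if $\varphi(E(g))=E(\widetilde g)$ and, for all $x\in E(g)$, the image under $\varphi^{-1}$ of $\lambda^{(\widetilde g)}_{\varphi(x)}$ is a positive scalar multiple of $\lambda_x^{(g)}$. *)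

theory Defs
  imports "HOL-Probability.Probability_Measure"
begin

text \<open>
  The alphabet is a finite type. A family indexed by a set \<open>J\<close> of integers is represented by a
  function that is \<^const>\<open>undefined\<close> outside \<open>J\<close>; such functions form the carrier of
  \<open>seqtop J\<close>.
\<close>

definition seqtop :: "int set \<Rightarrow> (int \<Rightarrow> 'a) topology" where
  "seqtop J = product_topology (\<lambda>_. discrete_topology UNIV) J"

definition translate :: "int \<Rightarrow> (int \<Rightarrow> 'a) \<Rightarrow> int \<Rightarrow> 'a" where
  "translate n x = (\<lambda>j. x (j + n))"

abbreviation shift :: "(int \<Rightarrow> 'a) \<Rightarrow> int \<Rightarrow> 'a" where
  "shift \<equiv> translate 1"

definition subshift :: "(int \<Rightarrow> 'a::finite) set \<Rightarrow> bool" where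
  "subshift X \<longleftrightarrow> closedin (seqtop UNIV) X \<and> shift ` X = X"

definition topological_conjugacy ::
  "(int \<Rightarrow> 'a::finite) set \<Rightarrow> (int \<Rightarrow> 'b::finite) set \<Rightarrow> ((int \<Rightarrow> 'a) \<Rightarrow> int \<Rightarrow> 'b) \<Rightarrow> bool" where
  "topological_conjugacy X Y \<phi> \<longleftrightarrow>
     homeomorphic_map (subtopology (seqtop UNIV) X) (subtopology (seqtop UNIV) Y) \<phi> \<and>
     (\<forall>x\<in>X. \<phi> (shift x) = shift (\<phi> x))"

definition blocks :: "(int \<Rightarrow> 'a) set \<Rightarrow> int set \<Rightarrow> (int \<Rightarrow> 'a) set" where
  "blocks X J = (\<lambda>x. restrict x J) ` X"

definition admissible :: "(int \<Rightarrow> 'a) set \<Rightarrow> 'a list \<Rightarrow> bool" where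
  "admissible X w \<longleftrightarrow> (\<exists>x\<in>X. \<exists>i. \<forall>j<length w. x (i + int j) = w ! j)"

text \<open>For \<open>u\<close> indexed by \<open>{..i}\<close>, \<open>append_word i u b\<close> is \<open>(u, b)\<close>, indexed by \<open>{..i + length b}\<close>.\<close>

definition append_word :: "int \<Rightarrow> (int \<Rightarrow> 'a) \<Rightarrow> 'a list \<Rightarrow> int \<Rightarrow> 'a" where
  "append_word i u b =
     (\<lambda>j. if j \<le> i then u j
          else if j \<le> i + int (length b) then b ! nat (j - i - 1)
          else undefined)"

definition \<Gamma>_plus :: "(int \<Rightarrow> 'a) set \<Rightarrow> int \<Rightarrow> nat \<Rightarrow> (int \<Rightarrow> 'a) \<Rightarrow> 'a list set" where
  "\<Gamma>_plus X i n u = {b. length b = n \<and> append_word i u b \<in> blocks X {..i + int n}}"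

definition \<Gamma>_minus :: "(int \<Rightarrow> 'a) set \<Rightarrow> 'a list \<Rightarrow> 'a list set" where
  "\<Gamma>_minus X a = {c. admissible X (c @ a)}"

text \<open>
  Left-infinite sequences are indexed by \<open>{..0}\<close>, so that \<open>(u, a)\<close> has to be translated
  by the length of \<open>a\<close> before it can be compared with \<open>blocks X {..0}\<close>.
\<close>

definition \<Gamma>_minus_inf :: "(int \<Rightarrow> 'a) set \<Rightarrow> 'a list \<Rightarrow> (int \<Rightarrow> 'a) set" where
  "\<Gamma>_minus_inf X a =
     {u \<in> extensional {..0}. translate (int (length a)) (append_word 0 u a) \<in> blocks X {..0}}"

definition \<omega>_plus :: "(int \<Rightarrow> 'a) set \<Rightarrow> nat \<Rightarrow> 'a list \<Rightarrow> 'a list set" where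
  "\<omega>_plus X n a =
     {b. length b = n \<and>
         (\<forall>u\<in>\<Gamma>_minus_inf X a.
            translate (int (length (a @ b))) (append_word 0 u (a @ b)) \<in> blocks X {..0})}"

definition property_D :: "(int \<Rightarrow> 'a) set \<Rightarrow> bool" where
  "property_D X \<longleftrightarrow>
     (\<forall>b \<sigma>. admissible X (b @ [\<sigma>]) \<longrightarrow> (\<exists>a\<in>\<Gamma>_minus X b. [\<sigma>] \<in> \<omega>_plus X 1 (a @ b)))"

definition residual_in :: "'x topology \<Rightarrow> 'x set \<Rightarrow> bool" where
  "residual_in T D \<longleftrightarrow>
     D \<subseteq> topspace T \<and> (\<exists>G\<subseteq>D. gdelta_in T G \<and> T closure_of G = topspace T)"

text \<open>
  A residually defined \<open>g\<close>-function is given by its domain \<open>D\<close> and a total function \<open>g\<close>, of which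
  only the values \<open>g u \<sigma>\<close> with \<open>u \<in> D\<close> are meaningful.
\<close>

definition residual_gfun ::
  "(int \<Rightarrow> 'a::finite) set \<Rightarrow> (int \<Rightarrow> 'a) set \<Rightarrow> ((int \<Rightarrow> 'a) \<Rightarrow> 'a \<Rightarrow> real) \<Rightarrow> bool" where
  "residual_gfun X D g \<longleftrightarrow>
     residual_in (subtopology (seqtop {..0}) (blocks X {..0})) D \<and>
     continuous_map (prod_topology (subtopology (seqtop {..0}) D) (discrete_topology UNIV))
       (top_of_set {0..1}) (\<lambda>(u, \<sigma>). g u \<sigma>) \<and>
     (\<forall>u\<in>D. (\<Sum>\<sigma> | [\<sigma>] \<in> \<Gamma>_plus X 0 1 u. g u \<sigma>) = 1) \<and>
     (\<forall>u\<in>D. \<forall>\<sigma>. [\<sigma>] \<notin> \<Gamma>_plus X 0 1 u \<longrightarrow> g u \<sigma> = 0) \<and>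
     \<not> (\<exists>p \<in> blocks X {..0} - D. \<exists>h.
          continuous_map (subtopology (seqtop {..0}) (insert p D)) (euclidean :: ('a \<Rightarrow> real) topology) h \<and>
          (\<forall>u\<in>D. h u = g u)) \<and>
     blocks X {..1} =
       seqtop {..1} closure_of
         {append_word 0 u [\<alpha>] | u \<alpha>. u \<in> D \<and> [\<alpha>] \<in> \<Gamma>_plus X 0 1 u \<and> g u \<alpha> > 0}"

definition gfun_range :: "(int \<Rightarrow> 'a) set \<Rightarrow> ((int \<Rightarrow> 'a) \<Rightarrow> 'a \<Rightarrow> real) \<Rightarrow> real set" where
  "gfun_range D g = {g u \<sigma> | u \<sigma>. u \<in> D}"

text \<open>
  Translation carries \<open>S\<^sup>-\<^sup>i D\<close>, a set of sequences indexed by \<open>{..i}\<close>, to \<open>D\<close>.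
  Here \<open>gfun_at g i u \<alpha>\<close> is the value \<open>g(u, \<alpha>)\<close> for \<open>u\<close> indexed by \<open>{..i}\<close>.
\<close>

definition dom_at :: "(int \<Rightarrow> 'a) set \<Rightarrow> int \<Rightarrow> (int \<Rightarrow> 'a) set" where
  "dom_at D i = translate i -` D"

definition gfun_at :: "((int \<Rightarrow> 'a) \<Rightarrow> 'a \<Rightarrow> real) \<Rightarrow> int \<Rightarrow> (int \<Rightarrow> 'a) \<Rightarrow> 'a \<Rightarrow> real" where
  "gfun_at g i u \<alpha> = g (translate i u) \<alpha>"

definition E_set ::
  "(int \<Rightarrow> 'a) set \<Rightarrow> (int \<Rightarrow> 'a) set \<Rightarrow> ((int \<Rightarrow> 'a) \<Rightarrow> 'a \<Rightarrow> real) \<Rightarrow> (int \<Rightarrow> 'a) set" where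
  "E_set X D g =
     {x \<in> X. \<forall>i. restrict x {..i} \<in> dom_at D i \<and>
        gfun_at g i (restrict x {..i}) (x (i + 1)) > 0 \<and>
        (\<forall>k. \<forall>a\<in>\<Gamma>_plus X i k (restrict x {..i}).
           append_word i (restrict x {..i}) a \<in> dom_at D (i + int k))}"

definition borel_in :: "'x topology \<Rightarrow> 'x measure" where
  "borel_in T = sigma (topspace T) {U. openin T U}"

definition fiber :: "(int \<Rightarrow> 'a) set \<Rightarrow> int \<Rightarrow> (int \<Rightarrow> 'a) \<Rightarrow> (int \<Rightarrow> 'a) set" where
  "fiber X i x = {y \<in> X. restrict y {..i} = restrict x {..i}}"

definition fiber_word :: "(int \<Rightarrow> 'a) set \<Rightarrow> int \<Rightarrow> (int \<Rightarrow> 'a) \<Rightarrow> 'a list \<Rightarrow> (int \<Rightarrow> 'a) set" where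
  "fiber_word X i x a = {y \<in> fiber X i x. \<forall>j<length a. y (i + 1 + int j) = a ! j}"

text \<open>
  \<open>is_mu X g i x M\<close> says that \<open>M\<close> is the measure \<open>\<mu>\<^sub>i(x\<^bsub>(-\<infinity>,i]\<^esub>)\<close>; it depends on \<open>x\<close> only
  through \<open>restrict x {..i}\<close>. The letters of \<open>a\<close> are counted from \<open>0\<close>.
\<close>

definition is_mu ::
  "(int \<Rightarrow> 'a) set \<Rightarrow> ((int \<Rightarrow> 'a) \<Rightarrow> 'a \<Rightarrow> real) \<Rightarrow> int \<Rightarrow> (int \<Rightarrow> 'a) \<Rightarrow> (int \<Rightarrow> 'a) measure \<Rightarrow> bool" where
  "is_mu X g i x M \<longleftrightarrow>
     prob_space M \<and>
     sets M = sets (borel_in (subtopology (seqtop UNIV) (fiber X i x))) \<and>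
     (\<forall>n. \<forall>a\<in>\<Gamma>_plus X i n (restrict x {..i}).
        emeasure M (fiber_word X i x a) =
          ennreal (\<Prod>k<n. gfun_at g (i + int k) (append_word i (restrict x {..i}) (take k a)) (a ! k)))"

text \<open>
  \<open>is_lambda X g x L\<close> says that \<open>L\<close> is one of the measures \<open>\<lambda>\<^sub>x\<close>, which are determined up to a positive
  factor.
\<close>

definition is_lambda ::
  "(int \<Rightarrow> 'a) set \<Rightarrow> ((int \<Rightarrow> 'a) \<Rightarrow> 'a \<Rightarrow> real) \<Rightarrow> (int \<Rightarrow> 'a) \<Rightarrow> (int \<Rightarrow> 'a) measure \<Rightarrow> bool" where
  "is_lambda X g x L \<longleftrightarrow>
     sigma_finite_measure L \<and>
     sets L = sets (borel_in (subtopology (seqtop UNIV) (\<Union>k::nat. fiber X (- int k) x))) \<and>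
     (\<forall>i. 0 < emeasure L (fiber X i x) \<and> emeasure L (fiber X i x) < \<infinity> \<and>
        is_mu X g i x
          (scale_measure (inverse (emeasure L (fiber X i x))) (restrict_space L (fiber X i x))))"

text \<open>
  Since \<open>\<lambda>\<^sub>x\<close> exists and is unique up to a positive factor for every \<open>x\<close> in \<open>E_set X D g\<close>, the
  choice of \<open>L\<close> and \<open>L'\<close> in the following definition is immaterial.
\<close>

definition gfun_image ::
  "(int \<Rightarrow> 'a::finite) set \<Rightarrow> (int \<Rightarrow> 'a) set \<Rightarrow> ((int \<Rightarrow> 'a) \<Rightarrow> 'a \<Rightarrow> real) \<Rightarrow>
   ((int \<Rightarrow> 'a) \<Rightarrow> int \<Rightarrow> 'b::finite) \<Rightarrow>
   (int \<Rightarrow> 'b) set \<Rightarrow> (int \<Rightarrow> 'b) set \<Rightarrow> ((int \<Rightarrow> 'b) \<Rightarrow> 'b \<Rightarrow> real) \<Rightarrow> bool" where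
  "gfun_image X D g \<phi> X' D' g' \<longleftrightarrow>
     \<phi> ` E_set X D g = E_set X' D' g' \<and>
     (\<forall>x\<in>E_set X D g. \<exists>L L' c. is_lambda X g x L \<and> is_lambda X' g' (\<phi> x) L' \<and>
        0 < c \<and> distr L' L (inv_into X \<phi>) = scale_measure (ennreal c) L)"

end

theory Submission
  imports Defs
begin

text \<open>
  Property (D) makes the projections of \<open>X\<close> to its left-infinite blocks semi-open, so that preimages
  of residual sets are residual, and by Baire's theorem \<open>E(g)\<close> is dense in \<open>X\<close>. For \<open>x\<close> in \<open>E(g)\<close> the
  value \<open>g(x\<^bsub>(-\<infinity>,i]\<^esub>, \<sigma>)\<close> is the ratio of the \<open>\<lambda>\<^sub>x\<close>-measures of \<open>F\<^sub>i(x, \<sigma>)\<close> and \<open>F\<^sub>i(x)\<close>.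
  If \<open>\<phi>\<close> and its inverse have coding window \<open>[-N, N]\<close>, then the preimage under \<open>\<phi>\<close> of such a set for
  \<open>\<phi>(x)\<close> is a disjoint union of sets \<open>F\<^bsub>i-N\<^esub>(x, a)\<close> with \<open>a\<close> of length \<open>2N + 1\<close>. Hence every value of
  the image of \<open>g\<close> at a point of \<open>E\<close> is a quotient of two sums of products of values of \<open>g\<close>, and if \<open>g\<close>
  has finite range only finitely many quotients occur. Density and continuity extend this to the whole
  domain.
\<close>

section \<open>Cylinders and comeager sets\<close>

text \<open>For fixed \<open>x\<close> these sets form a neighbourhood base at \<open>x\<close> in
  \<open>seqtop J\<close>, so open sets and closures are handled through them alone. Coordinates
  outside \<open>J\<close> are ignored, which allows a block to be compared with a point of
  \<open>X\<close>.\<close>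

definition near :: "int set \<Rightarrow> nat \<Rightarrow> (int \<Rightarrow> 'a) \<Rightarrow> (int \<Rightarrow> 'a) \<Rightarrow> bool" where
  "near J n x y \<longleftrightarrow> (\<forall>j\<in>J. \<bar>j\<bar> \<le> int n \<longrightarrow> y j = x j)"

lemma near_refl [simp]: "near J n x x"
  by (simp add: near_def)

lemma near_trans: "near J n x y \<Longrightarrow> near J n y z \<Longrightarrow> near J n x z"
  by (simp add: near_def)

lemma near_mono: "near J n x y \<Longrightarrow> m \<le> n \<Longrightarrow> near J m x y"
  by (auto simp: near_def)

lemma topspace_seqtop [simp]: "topspace (seqtop J) = extensional J"
  by (auto simp: seqtop_def PiE_def)

lemma openin_cylinder: "openin (seqtop J) {y \<in> extensional J. near J n x y}"
proof -
  have eq: "{y \<in> extensional J. near J n x y} = PiE J (\<lambda>j. if \<bar>j\<bar> \<le> int n then {x j} else UNIV)"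
    by (auto simp: near_def PiE_def Pi_iff split: if_splits)
  have "finite {i \<in> J. (if \<bar>i\<bar> \<le> int n then {x i} else UNIV) \<noteq> (UNIV :: 'a set)}"
    by (rule finite_subset[of _ "{- int n..int n}"]) (auto split: if_splits)
  then show ?thesis
    unfolding eq seqtop_def
    by (subst openin_PiE_gen) (auto simp: topspace_discrete_topology simp del: if_split)
qed

text \<open>A basic open set of the product constrains finitely many coordinates, all contained in
  some window \<open>[-n, n]\<close>. Conversely, cylinders are open because letters are isolated,
  and \<open>U\<close> is the trace on \<open>S\<close> of a union of cylinders.\<close>

lemma openin_sub_seqtop_iff:
  assumes "S \<subseteq> extensional J"
  shows "openin (subtopology (seqtop J) S) U \<longleftrightarrow>
    U \<subseteq> S \<and> (\<forall>x\<in>U. \<exists>n. \<forall>y\<in>S. near J n x y \<longrightarrow> y \<in> U)"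
proof
  assume "openin (subtopology (seqtop J) S) U"
  then obtain T where T: "openin (seqtop J) T" "U = T \<inter> S"
    by (auto simp: openin_subtopology)
  have "\<exists>n. \<forall>y\<in>S. near J n x y \<longrightarrow> y \<in> U" if "x \<in> U" for x
  proof -
    have "\<exists>V. finite {i \<in> J. V i \<noteq> topspace (discrete_topology (UNIV :: 'a set))} \<and>
        (\<forall>i\<in>J. openin (discrete_topology UNIV) (V i)) \<and> x \<in> PiE J V \<and> PiE J V \<subseteq> T"
      using T(1) that unfolding seqtop_def openin_product_topology_alt T(2) by (rule bspec[OF _ IntD1])
    then obtain V where V: "finite {i \<in> J. V i \<noteq> (UNIV :: 'a set)}" "x \<in> PiE J V" "PiE J V \<subseteq> T"
      by (elim exE conjE) (simp only: topspace_discrete_topology)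
    obtain n where n: "\<And>i. i \<in> J \<Longrightarrow> V i \<noteq> UNIV \<Longrightarrow> nat \<bar>i\<bar> \<le> n"
      using finite_imageI[OF V(1), of "\<lambda>i. nat \<bar>i\<bar>"] by (auto simp: finite_nat_set_iff_bounded_le)
    have "y \<in> U" if y: "y \<in> S" "near J n x y" for y
    proof -
      have "y j \<in> V j" if "j \<in> J" for j
      proof (cases "V j = UNIV")
        case False
        then have "\<bar>j\<bar> \<le> int n" using n[OF that] by simp
        then have "y j = x j" using y that by (auto simp: near_def)
        then show ?thesis using V(2) that by auto
      qed auto
      then have "y \<in> PiE J V" using y assms by (auto simp: PiE_def)
      then show ?thesis using V T y by auto
    qed
    then show ?thesis by blast
  qed
  then show "U \<subseteq> S \<and> (\<forall>x\<in>U. \<exists>n. \<forall>y\<in>S. near J n x y \<longrightarrow> y \<in> U)" using T by auto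
next
  assume R: "U \<subseteq> S \<and> (\<forall>x\<in>U. \<exists>n. \<forall>y\<in>S. near J n x y \<longrightarrow> y \<in> U)"
  then obtain n where n: "\<And>x y. x \<in> U \<Longrightarrow> y \<in> S \<Longrightarrow> near J (n x) x y \<Longrightarrow> y \<in> U"
    by metis
  let ?T = "\<Union>x\<in>U. {y \<in> extensional J. near J (n x) x y}"
  have "openin (seqtop J) ?T" by (intro openin_Union) (auto simp: openin_cylinder)
  moreover have "U = ?T \<inter> S"
  proof
    show "U \<subseteq> ?T \<inter> S" using R assms near_refl by fast
    show "?T \<inter> S \<subseteq> U" using n by blast
  qed
  ultimately show "openin (subtopology (seqtop J) S) U" unfolding openin_subtopology by blast
qed

lemma openin_sub_seqtopE:
  assumes "openin (subtopology (seqtop J) S) U" "S \<subseteq> extensional J" "x \<in> U"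
  obtains n where "\<forall>y\<in>S. near J n x y \<longrightarrow> y \<in> U"
  using assms(1)[unfolded openin_sub_seqtop_iff[OF assms(2)]] assms(3) by meson

lemma in_closure_sub_seqtop_iff:
  assumes "S \<subseteq> extensional J"
  shows "x \<in> subtopology (seqtop J) S closure_of A \<longleftrightarrow>
    x \<in> S \<and> (\<forall>n. \<exists>y \<in> A \<inter> S. near J n x y)"
proof -
  have ts: "topspace (subtopology (seqtop J) S) = S" using assms by auto
  have op: "openin (subtopology (seqtop J) S) {y \<in> S. near J n x y}" for n
    unfolding openin_sub_seqtop_iff[OF assms] by (auto intro: near_trans)
  show ?thesis
  proof
    assume L: "x \<in> subtopology (seqtop J) S closure_of A"
    then have "x \<in> S" using ts by (auto simp: in_closure_of)
    moreover have "\<exists>y \<in> A \<inter> S. near J n x y" for n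
    proof -
      have "x \<in> {y \<in> S. near J n x y}" using \<open>x \<in> S\<close> by simp
      then have "\<exists>y. y \<in> A \<and> y \<in> {y \<in> S. near J n x y}"
        using L op[of n] by (simp only: in_closure_of)
      then show ?thesis by blast
    qed
    ultimately show "x \<in> S \<and> (\<forall>n. \<exists>y \<in> A \<inter> S. near J n x y)" by blast
  next
    assume R: "x \<in> S \<and> (\<forall>n. \<exists>y \<in> A \<inter> S. near J n x y)"
    show "x \<in> subtopology (seqtop J) S closure_of A"
      unfolding in_closure_of ts openin_sub_seqtop_iff[OF assms]
    proof (intro conjI allI impI)
      show "x \<in> S" using R by blast
      fix U assume U: "x \<in> U \<and> U \<subseteq> S \<and> (\<forall>x\<in>U. \<exists>n. \<forall>y\<in>S. near J n x y \<longrightarrow> y \<in> U)"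
      then obtain n where "\<forall>y\<in>S. near J n x y \<longrightarrow> y \<in> U" by metis
      then show "\<exists>y. y \<in> A \<and> y \<in> U" using R by blast
    qed
  qed
qed

lemma in_closure_seqtop_iff:
  fixes x :: "int \<Rightarrow> 'a"
  shows "x \<in> seqtop J closure_of A \<longleftrightarrow>
    x \<in> extensional J \<and> (\<forall>n. \<exists>y \<in> A \<inter> extensional J. near J n x y)"
  using in_closure_sub_seqtop_iff[of "extensional J" J x A] subtopology_topspace[of "seqtop J :: (int \<Rightarrow> 'a) topology"]
  by simp

lemma compact_space_seqtop: "compact_space (seqtop J :: (int \<Rightarrow> 'a::finite) topology)"
  by (simp add: seqtop_def compact_space_product_topology compact_space_discrete_topology)

lemma Hausdorff_space_seqtop: "Hausdorff_space (seqtop J)"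
  by (simp add: seqtop_def Hausdorff_space_product_topology)

lemma continuous_map_restrict_seqtop:
  "J \<subseteq> K \<Longrightarrow> continuous_map (seqtop K) (seqtop J) (\<lambda>x. restrict x J)"
  unfolding seqtop_def
  by (auto simp: continuous_map_componentwise restrict_def extensional_def intro: continuous_map_product_projection)

lemma translate_0 [simp]: "translate 0 x = x"
  by (simp add: translate_def)

text \<open>Iterating the shift covers positive translations; negative ones use that
  \<open>shift\<close> maps \<open>X\<close> onto \<open>X\<close>.\<close>

lemma subshift_translate:
  assumes "subshift X" and "x \<in> X"
  shows "translate n x \<in> X"
proof -
  have sh: "translate 1 ` X = X" using assms(1) by (simp add: subshift_def)
  have tt: "translate a (translate b y) = translate (a + b) y" for a b and y :: "int \<Rightarrow> 'a"
    by (simp add: translate_def add.commute add.left_commute)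
  have pos: "translate (int k) y \<in> X" if "y \<in> X" for k y
  proof (induction k)
    case 0
    then show ?case using that by (simp add: translate_def)
  next
    case (Suc k)
    then have "translate 1 (translate (int k) y) \<in> X" using sh by blast
    then show ?case by (simp add: tt)
  qed
  have neg: "translate (- int k) y \<in> X" if "y \<in> X" for k y
  proof (induction k)
    case 0
    then show ?case using that by (simp add: translate_def)
  next
    case (Suc k)
    then obtain z where "z \<in> X" "translate 1 z = translate (- int k) y" using sh by (metis imageE)
    moreover then have "translate (-1) (translate 1 z) = translate (- int (Suc k)) y"
      by (simp add: tt)
    ultimately show ?case using tt[of "-1" 1 z] tt[of "-1" "- int k" y] by simp
  qed
  show ?thesis using pos[OF assms(2), of "nat n"] neg[OF assms(2), of "nat (- n)"]
    by (cases "n \<ge> 0") auto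
qed

lemma subshift_compact: "subshift X \<Longrightarrow> compact_space (subtopology (seqtop UNIV) X)"
  by (simp add: subshift_def closedin_compact_space compact_space_seqtop compact_space_subtopology)

text \<open>Restriction is continuous and \<open>X\<close> is compact, the alphabet being finite, so
  its image is a compact subset of a Hausdorff space.\<close>

lemma closedin_blocks:
  assumes "subshift X"
  shows "closedin (seqtop J) (blocks X J)"
proof -
  have "compactin (seqtop UNIV) X"
    using assms compact_space_seqtop by (auto simp: subshift_def intro: closedin_compact_space)
  then have "compactin (seqtop J) (blocks X J)"
    unfolding blocks_def by (intro image_compactin[OF _ continuous_map_restrict_seqtop]) auto
  then show ?thesis by (intro compactin_imp_closedin Hausdorff_space_seqtop)
qed

section \<open>Comeager properties and Baire's theorem\<close>

text \<open>A countable family of dense open sets is kept instead of one G-delta set, so that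
  countably many conditions are combined by uniting their families. The intersection with
  \<open>topspace T\<close> gives the empty family its meaning.\<close>

definition comeager :: "'x topology \<Rightarrow> ('x \<Rightarrow> bool) \<Rightarrow> bool" where
  "comeager T P \<longleftrightarrow> (\<exists>\<G>. countable \<G> \<and> (\<forall>U\<in>\<G>. openin T U \<and> T closure_of U = topspace T) \<and>
     (\<forall>x \<in> topspace T \<inter> \<Inter>\<G>. P x))"

lemma comeager_open_dense:
  "openin T U \<Longrightarrow> T closure_of U = topspace T \<Longrightarrow> (\<And>x. x \<in> U \<Longrightarrow> P x) \<Longrightarrow> comeager T P"
  unfolding comeager_def by (intro exI[of _ "{U}"]) auto

lemma comeager_countable_all:
  fixes P :: "'i::countable \<Rightarrow> 'x \<Rightarrow> bool"
  assumes "\<And>i. comeager T (P i)"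
  shows "comeager T (\<lambda>x. \<forall>i. P i x)"
proof -
  obtain \<G> where "\<And>i. countable (\<G> i)" "\<And>i U. U \<in> \<G> i \<Longrightarrow> openin T U \<and> T closure_of U = topspace T"
     "\<And>i x. x \<in> topspace T \<inter> \<Inter>(\<G> i) \<Longrightarrow> P i x"
    using assms unfolding comeager_def by metis
  then show ?thesis unfolding comeager_def
    by (intro exI[of _ "\<Union>i. \<G> i"]) (auto intro!: countable_UN)
qed

lemma comeager_conj:
  assumes "comeager T P" "comeager T Q"
  shows "comeager T (\<lambda>x. P x \<and> Q x)"
proof -
  have "comeager T (\<lambda>x. \<forall>b::bool. (if b then P else Q) x)"
    using assms by (intro comeager_countable_all) auto
  then show ?thesis by (auto simp: all_bool_eq conj_commute)
qed

lemma comeager_mono: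
  "comeager T P \<Longrightarrow> (\<And>x. x \<in> topspace T \<Longrightarrow> P x \<Longrightarrow> Q x) \<Longrightarrow> comeager T Q"
  unfolding comeager_def by (meson IntD1)

text \<open>This is Baire's theorem, applicable because a compact Hausdorff space is locally compact
  and regular.\<close>

lemma comeager_dense:
  assumes "compact_space T" "Hausdorff_space T" "comeager T P"
  shows "T closure_of {x \<in> topspace T. P x} = topspace T"
proof -
  obtain \<G> where \<G>: "countable \<G>" "\<And>U. U \<in> \<G> \<Longrightarrow> openin T U \<and> T closure_of U = topspace T"
     "\<And>x. x \<in> topspace T \<inter> \<Inter>\<G> \<Longrightarrow> P x"
    using assms unfolding comeager_def by metis
  have "T closure_of (\<Inter>\<G>) = topspace T"
    using assms by (intro Baire_category \<G>)
      (auto simp: compact_imp_locally_compact_space compact_Hausdorff_imp_regular_space)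
  moreover have "T closure_of (\<Inter>\<G>) \<subseteq> T closure_of {x \<in> topspace T. P x}"
  proof -
    have "T closure_of (\<Inter>\<G>) = T closure_of (topspace T \<inter> \<Inter>\<G>)" by (rule closure_of_restrict)
    also have "\<dots> \<subseteq> T closure_of {x \<in> topspace T. P x}" using \<G> by (intro closure_of_mono) auto
    finally show ?thesis .
  qed
  ultimately show ?thesis using closure_of_subset_topspace[of T "{x \<in> topspace T. P x}"] by auto
qed

text \<open>Each open set in the representation of \<open>G\<close> contains \<open>G\<close> and is
  therefore dense itself.\<close>

lemma residual_in_comeager:
  assumes "residual_in T D"
  shows "comeager T (\<lambda>x. x \<in> D)"
proof -
  obtain G where G: "G \<subseteq> D" "gdelta_in T G" "T closure_of G = topspace T"
    using assms by (auto simp: residual_in_def)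
  then obtain \<U> where U: "countable \<U>" "\<And>U. U \<in> \<U> \<Longrightarrow> openin T U" "G = topspace T \<inter> \<Inter>\<U>"
    unfolding gdelta_in_def relative_to_def intersection_of_def by auto
  have "T closure_of U = topspace T" if "U \<in> \<U>" for U
  proof -
    have "T closure_of G \<subseteq> T closure_of U" using U that by (intro closure_of_mono) auto
    then show ?thesis using G closure_of_subset_topspace[of T U] by auto
  qed
  then show ?thesis unfolding comeager_def using U G by (intro exI[of _ \<U>]) auto
qed

text \<open>Continuity makes preimages of open sets open. Density of the preimages does not follow
  from it and is left as a hypothesis, which is verified for translations directly and for
  projections to the past through property (D).\<close>

lemma comeager_preimage:
  assumes "comeager T P" and "continuous_map S T f"
    and "\<And>U. openin T U \<Longrightarrow> T closure_of U = topspace T \<Longrightarrow>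
        S closure_of {x \<in> topspace S. f x \<in> U} = topspace S"
  shows "comeager S (\<lambda>x. P (f x))"
proof -
  obtain \<G> where \<G>: "countable \<G>" "\<And>U. U \<in> \<G> \<Longrightarrow> openin T U \<and> T closure_of U = topspace T"
     "\<And>x. x \<in> topspace T \<inter> \<Inter>\<G> \<Longrightarrow> P x"
    using assms unfolding comeager_def by metis
  have "f x \<in> topspace T" if "x \<in> topspace S" for x
    using assms(2) that by (auto simp: continuous_map_def)
  then show ?thesis unfolding comeager_def
    using \<G> assms(2,3)
    by (intro exI[of _ "(\<lambda>U. {x \<in> topspace S. f x \<in> U}) ` \<G>"])
       (auto intro: openin_continuous_map_preimage)
qed

section \<open>Property (D) and projections to the past\<close>

text \<open>Words are anchored at their last position, because property (D) lengthens them to the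
  left while their right end stays fixed.\<close>

definition ends :: "(int \<Rightarrow> 'a) \<Rightarrow> int \<Rightarrow> 'a list \<Rightarrow> bool" where
  "ends y i w \<longleftrightarrow> (\<forall>j<length w. y (i - int (length w) + 1 + int j) = w ! j)"

lemma ends_append:
  "ends y (i + int (length v)) (u @ v) \<longleftrightarrow> ends y i u \<and> ends y (i + int (length v)) v"
proof -
  have "(\<forall>j<length (u @ v). y (i + int (length v) - int (length (u @ v)) + 1 + int j) = (u @ v) ! j) \<longleftrightarrow>
    (\<forall>j<length u. y (i - int (length u) + 1 + int j) = u ! j) \<and> (\<forall>j<length v. y (i + 1 + int j) = v ! j)"
    (is "?L \<longleftrightarrow> ?R")
  proof
    assume L: ?L
    show ?R
    proof (intro conjI allI impI)
      fix j assume "j < length u"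
      then show "y (i - int (length u) + 1 + int j) = u ! j"
        using L[rule_format, of j] by (simp add: nth_append algebra_simps)
    next
      fix j assume "j < length v"
      then show "y (i + 1 + int j) = v ! j"
        using L[rule_format, of "length u + j"] by (simp add: nth_append algebra_simps)
    qed
  next
    assume R: ?R
    show ?L
    proof (intro allI impI)
      fix j assume j: "j < length (u @ v)"
      show "y (i + int (length v) - int (length (u @ v)) + 1 + int j) = (u @ v) ! j"
      proof (cases "j < length u")
        case True
        then show ?thesis using R by (simp add: nth_append algebra_simps)
      next
        case False
        then obtain k where "j = length u + k" by (metis le_add_diff_inverse not_less)
        then show ?thesis using R j by (simp add: nth_append algebra_simps)
      qed
    qed
  qed
  then show ?thesis by (simp add: ends_def)
qed

lemma ends_cong: "(\<And>j. j \<le> i \<Longrightarrow> z j = y j) \<Longrightarrow> ends z i w \<longleftrightarrow> ends y i w"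
  by (auto simp: ends_def)

lemma ends_singleton [simp]: "ends y i [s] \<longleftrightarrow> y i = s"
  by (simp add: ends_def)

lemma ends_map_upto:
  assumes "k \<le> m + 1"
  shows "ends y m (map z [k..m]) \<longleftrightarrow> (\<forall>j. k \<le> j \<and> j \<le> m \<longrightarrow> y j = z j)"
proof
  assume L: "ends y m (map z [k..m])"
  have "y j = z j" if "k \<le> j" "j \<le> m" for j
    using L[unfolded ends_def, rule_format, of "nat (j - k)"] that by simp
  then show "\<forall>j. k \<le> j \<and> j \<le> m \<longrightarrow> y j = z j" by blast
qed (use assms in \<open>auto simp: ends_def\<close>)

text \<open>By shift invariance an occurrence of \<open>w\<close> can be moved so that it ends at
  any prescribed \<open>i\<close>.\<close>

lemma admissible_ends:
  assumes "subshift X"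
  shows "admissible X w \<longleftrightarrow> (\<exists>y\<in>X. ends y i w)"
proof
  assume "admissible X w"
  then obtain x s where x: "x \<in> X" "\<forall>j<length w. x (s + int j) = w ! j"
    by (auto simp: admissible_def)
  let ?y = "translate (s - (i - int (length w) + 1)) x"
  have "ends ?y i w" using x by (auto simp: ends_def translate_def algebra_simps)
  then show "\<exists>y\<in>X. ends y i w" using subshift_translate[OF assms x(1)] by blast
qed (auto simp: ends_def admissible_def)

lemma translate_restrict: "translate n (restrict y {..m}) = restrict (translate n y) {..m - n}"
  by (auto simp: translate_def restrict_def)

lemma translate_translate: "translate a (translate b y) = translate (a + b) y"
  by (simp add: translate_def add.commute add.left_commute)

text \<open>This replaces the block notation of the definitions by coordinatewise agreement of
  points, the form used in all later arguments.\<close>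

lemma append_word_restrict_iff:
  "append_word i (restrict x {..i}) w = restrict y {..i + int (length w)} \<longleftrightarrow>
    (\<forall>j\<le>i. y j = x j) \<and> (\<forall>j<length w. y (i + 1 + int j) = w ! j)"
proof
  assume L: "append_word i (restrict x {..i}) w = restrict y {..i + int (length w)}"
  have "y j = x j" if "j \<le> i" for j
    using fun_cong[OF L, of j] that by (simp add: append_word_def)
  moreover have "y (i + 1 + int j) = w ! j" if "j < length w" for j
    using fun_cong[OF L, of "i + 1 + int j"] that by (simp add: append_word_def)
  ultimately show "(\<forall>j\<le>i. y j = x j) \<and> (\<forall>j<length w. y (i + 1 + int j) = w ! j)" by blast
next
  assume R: "(\<forall>j\<le>i. y j = x j) \<and> (\<forall>j<length w. y (i + 1 + int j) = w ! j)"
  have "y j = w ! nat (j - i - 1)" if "i < j" "j \<le> i + int (length w)" for j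
    using R[THEN conjunct2, rule_format, of "nat (j - i - 1)"] that by simp
  then show "append_word i (restrict x {..i}) w = restrict y {..i + int (length w)}"
    using R by (auto simp: append_word_def restrict_def)
qed

lemma \<Gamma>_plus_iff:
  "a \<in> \<Gamma>_plus X i n (restrict x {..i}) \<longleftrightarrow> length a = n \<and> fiber_word X i x a \<noteq> {}"
proof -
  have "restrict y {..i} = restrict x {..i} \<longleftrightarrow> (\<forall>j\<le>i. y j = x j)" for y :: "int \<Rightarrow> 'a"
    by (auto simp: restrict_def fun_eq_iff)
  then show ?thesis
    unfolding \<Gamma>_plus_def fiber_word_def fiber_def blocks_def
    by (auto simp: append_word_restrict_iff)
qed

lemma translate_append_word: "translate i (append_word i u a) = append_word 0 (translate i u) a"
  by (auto simp: translate_def append_word_def)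

text \<open>Property (D) rephrased for points: \<open>\<omega>_plus\<close> quantifies over all
  pasts that can precede \<open>a @ b\<close>, and after a translation the past of every point
  showing \<open>a @ b\<close> is one of them, so \<open>\<sigma>\<close> can follow.\<close>

lemma property_D_extend:
  assumes "subshift X" "property_D X" "admissible X (b @ [\<sigma>])"
  shows "\<exists>a. admissible X (a @ b) \<and>
    (\<forall>y\<in>X. \<forall>i. ends y i (a @ b) \<longrightarrow> (\<exists>z\<in>X. (\<forall>j\<le>i. z j = y j) \<and> z (i + 1) = \<sigma>))"
proof -
  obtain a where a: "a \<in> \<Gamma>_minus X b" "[\<sigma>] \<in> \<omega>_plus X 1 (a @ b)"
    using assms(2,3) unfolding property_D_def by blast
  let ?L = "int (length (a @ b))"
  have "\<exists>z\<in>X. (\<forall>j\<le>i. z j = y j) \<and> z (i + 1) = \<sigma>" if y: "y \<in> X" "ends y i (a @ b)" for y i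
  proof -
    \<comment> \<open>The translation places \<open>a @ b\<close> on the coordinates from 1 to
      \<open>?L\<close>, so that \<open>u\<close> is exactly the past preceding the word.\<close>
    define y' where "y' = translate (i - ?L) y"
    define u where "u = restrict y' {..0}"
    have ab: "\<forall>j<length (a @ b). y' (0 + 1 + int j) = (a @ b) ! j"
      using y(2) by (simp add: ends_def y'_def translate_def algebra_simps)
    then have "append_word 0 u (a @ b) = restrict y' {..0 + ?L}"
      unfolding u_def by (subst append_word_restrict_iff) auto
    then have "translate ?L (append_word 0 u (a @ b)) = restrict (translate ?L y') {..0}"
      by (simp add: translate_restrict)
    moreover have "translate ?L y' \<in> X"
      unfolding y'_def by (intro subshift_translate[OF assms(1)] y(1))
    ultimately have "u \<in> \<Gamma>_minus_inf X (a @ b)"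
      by (auto simp: \<Gamma>_minus_inf_def u_def blocks_def)
    then have "translate (int (length ((a @ b) @ [\<sigma>]))) (append_word 0 u ((a @ b) @ [\<sigma>])) \<in> blocks X {..0}"
      using a(2) unfolding \<omega>_plus_def by blast
    then obtain z where z: "z \<in> X"
      "translate (?L + 1) (append_word 0 u ((a @ b) @ [\<sigma>])) = restrict z {..0}"
      unfolding blocks_def by (auto simp: algebra_simps)
    have "translate (- (?L + 1)) (translate (?L + 1) (append_word 0 u ((a @ b) @ [\<sigma>]))) =
      restrict (translate (- (?L + 1)) z) {..?L + 1}"
      unfolding z(2) by (simp add: translate_restrict algebra_simps)
    then have "append_word 0 u ((a @ b) @ [\<sigma>]) = restrict (translate (- (?L + 1)) z) {..?L + 1}"
      unfolding translate_translate by simp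
    then have eq: "append_word 0 (restrict y' {..0}) ((a @ b) @ [\<sigma>]) =
        restrict (translate (- (?L + 1)) z) {..0 + int (length ((a @ b) @ [\<sigma>]))}"
      unfolding u_def by (simp add: algebra_simps)
    have z1: "translate (- (?L + 1)) z j = y' j" if "j \<le> 0" for j
      using eq[unfolded append_word_restrict_iff] that by blast
    have z2: "translate (- (?L + 1)) z (0 + 1 + int j) = ((a @ b) @ [\<sigma>]) ! j" if "j < length (a @ b) + 1" for j
      using eq[unfolded append_word_restrict_iff] that by (metis length_append_singleton Suc_eq_plus1)
    \<comment> \<open>In \<open>z\<close> the new letter stands at coordinate 0; this translation
      moves it to \<open>i + 1\<close>.\<close>
    define z' where "z' = translate (- i - 1) z"
    have "z' (i + 1) = \<sigma>"
      using z2[of "length (a @ b)"] by (simp add: z'_def translate_def nth_append)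
    \<comment> \<open>To the left of the word the two points agree through \<open>u\<close>; inside
      the word both spell \<open>a @ b\<close>.\<close>
    moreover have "z' j = y j" if "j \<le> i" for j
    proof (cases "j \<le> i - ?L")
      case True
      then show ?thesis using z1[of "j - i + ?L"] by (simp add: z'_def y'_def translate_def algebra_simps)
    next
      case False
      define k where "k = nat (j - i + ?L - 1)"
      have k: "j - i + ?L = 0 + 1 + int k" "k < length (a @ b)" using False that by (auto simp: k_def)
      have "z' j = translate (- (?L + 1)) z (j - i + ?L)" by (simp add: z'_def translate_def)
      also have "\<dots> = (a @ b) ! k" 
      proof -
        have "((a @ b) @ [\<sigma>]) ! k = (a @ b) ! k" using k(2) by (simp only: nth_append if_True)
        then show ?thesis unfolding k(1) using z2[of k] k(2) by (metis less_Suc_eq Suc_eq_plus1)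
      qed
      also have "\<dots> = y' (0 + 1 + int k)" using ab k(2) by simp
      also have "\<dots> = y j" unfolding k(1)[symmetric] by (simp add: y'_def translate_def)
      finally show ?thesis .
    qed
    ultimately show ?thesis using subshift_translate[OF assms(1) z(1)] unfolding z'_def by blast
  qed
  then show ?thesis using a(1) unfolding \<Gamma>_minus_def by blast
qed

text \<open>Induction on the last letter of \<open>c\<close>. The prefix \<open>a1\<close> that lets
  \<open>\<sigma>\<close> follow \<open>b @ c\<close> is chosen first; the induction hypothesis for
  the longer word \<open>a1 @ b\<close> then gives a prefix \<open>a2\<close> that lets
  \<open>c\<close> follow. Once \<open>c\<close> has been appended, the point ends with
  \<open>a1 @ b @ c\<close> and \<open>\<sigma>\<close> can be appended as well.\<close>

lemma property_D_extend_word: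
  assumes "subshift X" "property_D X" "admissible X (b @ c)"
  shows "\<exists>a. admissible X (a @ b) \<and>
    (\<forall>y\<in>X. \<forall>i. ends y i (a @ b) \<longrightarrow>
      (\<exists>z\<in>X. (\<forall>j\<le>i. z j = y j) \<and> ends z (i + int (length c)) c))"
  using assms(3)
proof (induction c arbitrary: b rule: rev_induct)
  case Nil
  then show ?case by (intro exI[of _ "[]"]) (auto simp: ends_def)
next
  case (snoc \<sigma> c)
  then obtain a1 where a1: "admissible X (a1 @ b @ c)"
    "\<And>y i. y \<in> X \<Longrightarrow> ends y i (a1 @ b @ c) \<Longrightarrow> \<exists>z\<in>X. (\<forall>j\<le>i. z j = y j) \<and> z (i + 1) = \<sigma>"
    using property_D_extend[OF assms(1,2), of "b @ c" \<sigma>] by auto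
  obtain a2 where a2: "admissible X (a2 @ a1 @ b)"
    "\<And>y i. y \<in> X \<Longrightarrow> ends y i (a2 @ a1 @ b) \<Longrightarrow>
      \<exists>z\<in>X. (\<forall>j\<le>i. z j = y j) \<and> ends z (i + int (length c)) c"
    using snoc.IH[of "a1 @ b"] a1(1) by auto
  have "\<exists>z\<in>X. (\<forall>j\<le>i. z j = y j) \<and> ends z (i + int (length (c @ [\<sigma>]))) (c @ [\<sigma>])"
    if y: "y \<in> X" "ends y i (a2 @ a1 @ b)" for y i
  proof -
    let ?k = "i + int (length c)"
    obtain z1 where z1: "z1 \<in> X" "\<forall>j\<le>i. z1 j = y j" "ends z1 ?k c"
      using a2(2)[OF y] by blast
    \<comment> \<open>\<open>z1\<close> keeps the past of \<open>y\<close>, hence still ends with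
      \<open>a1 @ b\<close> at \<open>i\<close>; together with the appended \<open>c\<close> this is
      the word that admits \<open>\<sigma>\<close>.\<close>
    have "ends z1 i (a2 @ a1 @ b)" using y(2) ends_cong[of i z1 y] z1(2) by auto
    then have "ends z1 i (a1 @ b)"
      using ends_append[of z1 "i - int (length (a1 @ b))" "a1 @ b" a2] by simp
    then have "ends z1 ?k (a1 @ b @ c)" using z1(3) ends_append[of z1 i c "a1 @ b"] by simp
    then obtain z2 where z2: "z2 \<in> X" "\<forall>j\<le>?k. z2 j = z1 j" "z2 (?k + 1) = \<sigma>"
      using a1(2)[OF z1(1)] by blast
    have "ends z2 ?k c" using ends_cong[of ?k z2 z1 c] z2(2) z1(3) by blast
    then have "ends z2 (?k + int (length [\<sigma>])) (c @ [\<sigma>])"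
      unfolding ends_append using z2(3) by simp
    then have "ends z2 (i + int (length (c @ [\<sigma>]))) (c @ [\<sigma>])" by (simp add: algebra_simps)
    then show ?thesis using z2 z1(2) by (intro bexI[of _ z2]) auto
  qed
  then show ?case using a2(1) by (intro exI[of _ "a2 @ a1"]) auto
qed

text \<open>
  The image of a cylinder of \<open>X\<close> in \<open>X\<^bsub>(-\<infinity>,i]\<^esub>\<close> has nonempty interior. Property (D) enters the proof
  of the theorem only through this fact.
\<close>

lemma property_D_semi_open:
  assumes "subshift X" "property_D X" "x \<in> X"
  shows "\<exists>y\<in>X. \<exists>p. \<forall>y'\<in>X. near {..i} p y y' \<longrightarrow>
    (\<exists>x'\<in>X. (\<forall>j\<le>i. x' j = y' j) \<and> near UNIV n x x')"
proof -
  \<comment> \<open>The window \<open>[-m, m]\<close> contains both \<open>[-n, n]\<close> and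
    \<open>i\<close>. It is cut at \<open>i\<close> into the past part \<open>b\<close> and the
    future part \<open>c\<close> of \<open>x\<close>.\<close>
  define m where "m = int n + \<bar>i\<bar>"
  have m: "int n \<le> m" "- m \<le> i" "i \<le> m" by (auto simp: m_def)
  define b c where "b = map x [-m..i]" and "c = map x [i+1..m]"
  have len: "int (length c) = m - i" using m by (simp add: c_def)
  have "ends x i b" unfolding b_def using m by (subst ends_map_upto) auto
  moreover have "ends x m c" unfolding c_def using m by (subst ends_map_upto) auto
  ultimately have "ends x (i + int (length c)) (b @ c)"
    using ends_append[of x i c b] by (simp add: len)
  then have "admissible X (b @ c)" using admissible_ends[OF assms(1)] assms(3) by blast
  then obtain a where a: "admissible X (a @ b)"
    "\<And>y j. y \<in> X \<Longrightarrow> ends y j (a @ b) \<Longrightarrow>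
      \<exists>z\<in>X. (\<forall>k\<le>j. z k = y k) \<and> ends z (j + int (length c)) c"
    using property_D_extend_word[OF assms(1,2)] by blast
  obtain y where y: "y \<in> X" "ends y i (a @ b)"
    using a(1) admissible_ends[OF assms(1)] by blast
  \<comment> \<open>Large enough that agreement with \<open>y\<close> on this window forces the
    occurrence of \<open>a @ b\<close> ending at \<open>i\<close>.\<close>
  define p where "p = nat \<bar>i\<bar> + length (a @ b)"
  have "\<exists>x'\<in>X. (\<forall>j\<le>i. x' j = y' j) \<and> near UNIV n x x'" if y': "y' \<in> X" "near {..i} p y y'" for y'
  proof -
    have "ends y' i (a @ b)"
      using y(2) y'(2) by (auto simp: ends_def near_def p_def)
    then obtain z where z: "z \<in> X" "\<forall>k\<le>i. z k = y' k" "ends z m c"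
    proof -
      have "i + int (length c) = m" using len by simp
      then show ?thesis using that a(2)[OF y'(1) \<open>ends y' i (a @ b)\<close>] by auto
    qed
    have "ends y' i b"
      using \<open>ends y' i (a @ b)\<close> ends_append[of y' "i - int (length b)" b a] by simp
    then have "z j = x j" if "- m \<le> j" "j \<le> i" for j
      using that m z(2) unfolding b_def by (subst (asm) ends_map_upto) auto
    moreover have "z j = x j" if "i < j" "j \<le> m" for j
      using that m z(3) unfolding c_def by (subst (asm) ends_map_upto) auto
    ultimately have "near UNIV n x z" using m by (auto simp: near_def) (smt (verit))
    then show ?thesis using z by blast
  qed
  then show ?thesis using y(1) by blast
qed

section \<open>Density of the set \<open>E(g)\<close>\<close>

lemma subset_extensional_UNIV: "X \<subseteq> extensional UNIV"
  by (simp add: extensional_def)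

lemma blocks_extensional: "blocks X J \<subseteq> extensional J"
  by (auto simp: blocks_def)

lemma topspace_sub_seqtop: "S \<subseteq> extensional J \<Longrightarrow> topspace (subtopology (seqtop J) S) = S"
  by auto

lemma continuous_map_translate: "continuous_map (seqtop UNIV) (seqtop UNIV) (translate i)"
  unfolding seqtop_def
  by (auto simp: continuous_map_componentwise translate_def intro: continuous_map_product_projection)

lemma comeager_translate:
  assumes "subshift X" "comeager (subtopology (seqtop UNIV) X) P"
  shows "comeager (subtopology (seqtop UNIV) X) (\<lambda>x. P (translate i x))"
proof (rule comeager_preimage[OF assms(2)])
  show "continuous_map (subtopology (seqtop UNIV) X) (subtopology (seqtop UNIV) X) (translate i)"
    using subshift_translate[OF assms(1)] continuous_map_translate
    by (auto simp: continuous_map_in_subtopology intro: continuous_map_from_subtopology)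
next
  note cl = in_closure_sub_seqtop_iff[OF subset_extensional_UNIV, of _ X]
  fix U assume "subtopology (seqtop UNIV) X closure_of U = topspace (subtopology (seqtop UNIV) X)"
  then have U: "\<exists>y \<in> U \<inter> X. near UNIV n x y" if "x \<in> X" for x n
    using that cl[of x U] topspace_sub_seqtop[OF subset_extensional_UNIV, of X] by auto
  have "\<exists>y \<in> {x \<in> X. translate i x \<in> U} \<inter> X. near UNIV n x y" if x: "x \<in> X" for x n
  proof -
    \<comment> \<open>The extra \<open>nat \<bar>i\<bar>\<close> pays for translating
      \<open>u\<close> back.\<close>
    obtain u where u: "u \<in> U" "u \<in> X" "near UNIV (n + nat \<bar>i\<bar>) (translate i x) u"
      using U[OF subshift_translate[OF assms(1) x], of "n + nat \<bar>i\<bar>" i] by blast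
    have "translate i (translate (- i) u) = u" by (simp add: translate_def)
    moreover have "translate (- i) u \<in> X" by (rule subshift_translate[OF assms(1) u(2)])
    moreover have "near UNIV n x (translate (- i) u)"
      unfolding near_def
    proof (intro ballI impI)
      fix j :: int assume "\<bar>j\<bar> \<le> int n"
      then have "\<bar>j - i\<bar> \<le> int (n + nat \<bar>i\<bar>)" by linarith
      then have "u (j - i) = translate i x (j - i)" using u(3) by (simp add: near_def)
      then show "translate (- i) u j = x j" by (simp add: translate_def)
    qed
    ultimately show ?thesis using u by (intro bexI[of _ "translate (- i) u"]) auto
  qed
  then show "subtopology (seqtop UNIV) X closure_of
      {x \<in> topspace (subtopology (seqtop UNIV) X). translate i x \<in> U} =
      topspace (subtopology (seqtop UNIV) X)"
    unfolding topspace_sub_seqtop[OF subset_extensional_UNIV]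
    by (auto simp: cl)
qed

text \<open>Under projection to the past the cylinder around \<open>x\<close> covers a cylinder
  around some \<open>y\<close>. The dense set \<open>U\<close> has a block there, and that block
  lifts back to a point in the cylinder around \<open>x\<close>.\<close>

lemma comeager_restrict:
  assumes "subshift X" "property_D X"
    and "comeager (subtopology (seqtop {..i}) (blocks X {..i})) P"
  shows "comeager (subtopology (seqtop UNIV) X) (\<lambda>x. P (restrict x {..i}))"
proof (rule comeager_preimage[OF assms(3)])
  show "continuous_map (subtopology (seqtop UNIV) X) (subtopology (seqtop {..i}) (blocks X {..i}))
      (\<lambda>x. restrict x {..i})"
    using continuous_map_restrict_seqtop[of "{..i}" UNIV]
    by (auto simp: continuous_map_in_subtopology blocks_def intro!: continuous_map_from_subtopology)
next
  note clX = in_closure_sub_seqtop_iff[OF subset_extensional_UNIV, of _ X]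
  note clB = in_closure_sub_seqtop_iff[OF blocks_extensional, of _ "{..i}" X]
  fix U assume "subtopology (seqtop {..i}) (blocks X {..i}) closure_of U =
    topspace (subtopology (seqtop {..i}) (blocks X {..i}))"
  then have U: "\<exists>v \<in> U \<inter> blocks X {..i}. near {..i} n u v" if "u \<in> blocks X {..i}" for u n
    using that clB[of u U] topspace_sub_seqtop[OF blocks_extensional, of "{..i}" X] by auto
  have "\<exists>y \<in> {x \<in> X. restrict x {..i} \<in> U} \<inter> X. near UNIV n x y" if x: "x \<in> X" for x n
  proof -
    obtain y p where y: "y \<in> X" "\<And>y'. y' \<in> X \<Longrightarrow> near {..i} p y y' \<Longrightarrow>
      \<exists>x'\<in>X. (\<forall>j\<le>i. x' j = y' j) \<and> near UNIV n x x'"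
      using property_D_semi_open[OF assms(1,2) x, of i n] by blast
    have "restrict y {..i} \<in> blocks X {..i}" using y(1) by (simp add: blocks_def)
    then obtain y' where y': "y' \<in> X" "restrict y' {..i} \<in> U" "near {..i} p (restrict y {..i}) (restrict y' {..i})"
      using U[of _ p] unfolding blocks_def by blast
    then have "near {..i} p y y'" by (simp add: near_def)
    then obtain x' where x': "x' \<in> X" "\<forall>j\<le>i. x' j = y' j" "near UNIV n x x'"
      using y(2) y'(1) by blast
    have "restrict x' {..i} = restrict y' {..i}" using x'(2) by (auto simp: restrict_def)
    then show ?thesis using x' y' by auto
  qed
  then show "subtopology (seqtop UNIV) X closure_of
      {x \<in> topspace (subtopology (seqtop UNIV) X). restrict x {..i} \<in> U} =
      topspace (subtopology (seqtop UNIV) X)"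
    unfolding topspace_sub_seqtop[OF subset_extensional_UNIV]
    by (auto simp: clX)
qed

text \<open>The window does not have to grow: for \<open>j \<le> 0\<close> the new coordinate
  \<open>j\<close> is read at \<open>j + k\<close>, and if this is still at most 0 it is no farther
  from 0 than \<open>j\<close>.\<close>

lemma near_append_word:
  assumes "near {..0} n u u'"
  shows "near {..0} n (translate (int k) (append_word 0 u a)) (translate (int k) (append_word 0 u' a))"
  using assms unfolding near_def
proof (intro ballI impI)
  fix j :: int
  assume u: "\<forall>j\<in>{..0}. \<bar>j\<bar> \<le> int n \<longrightarrow> u' j = u j" and j: "j \<in> {..0}" "\<bar>j\<bar> \<le> int n"
  show "translate (int k) (append_word 0 u' a) j = translate (int k) (append_word 0 u a) j"
    using u[rule_format, of "j + int k"] j by (auto simp: translate_def append_word_def)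
qed

text \<open>
  The set of \<open>u\<close> with \<open>(u, a) \<in> X\<^bsub>(-\<infinity>,k]\<^esub>\<close> need not have dense interior, but it is closed, so a
  dense open \<open>U\<close> in \<open>X\<^bsub>(-\<infinity>,k]\<^esub>\<close> pulls back to a dense open set once its complement is added.
\<close>

lemma comeager_append_word:
  assumes "subshift X" and "length a = k"
    and "comeager (subtopology (seqtop {..0}) (blocks X {..0})) P"
  shows "comeager (subtopology (seqtop {..0}) (blocks X {..0}))
    (\<lambda>u. a \<in> \<Gamma>_plus X 0 k u \<longrightarrow> P (translate (int k) (append_word 0 u a)))"
proof -
  let ?B = "blocks X {..0}" and ?w = "\<lambda>u. translate (int k) (append_word 0 u a)"
  let ?T = "subtopology (seqtop {..0}) ?B"
  note ts = topspace_sub_seqtop[OF blocks_extensional, of "{..0}" X]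
  note op = openin_sub_seqtop_iff[OF blocks_extensional, of "{..0}" X]
  note cl = in_closure_sub_seqtop_iff[OF blocks_extensional, of _ "{..0}" X]
  have \<Gamma>: "?w u \<in> ?B" if "a \<in> \<Gamma>_plus X 0 k u" for u
  proof -
    obtain z where "z \<in> X" "append_word 0 u a = restrict z {..int k}"
      using \<open>a \<in> \<Gamma>_plus X 0 k u\<close> by (auto simp: \<Gamma>_plus_def blocks_def)
    then have "?w u = restrict (translate (int k) z) {..0}" by (simp add: translate_restrict)
    then show ?thesis using subshift_translate[OF assms(1) \<open>z \<in> X\<close>] by (auto simp: blocks_def)
  qed
  have w_ext: "?w u \<in> extensional {..0}" for u
    using assms(2) by (auto simp: extensional_def translate_def append_word_def)
  obtain \<G> where \<G>: "countable \<G>" "\<And>U. U \<in> \<G> \<Longrightarrow> openin ?T U \<and> ?T closure_of U = topspace ?T"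
     "\<And>u. u \<in> ?B \<inter> \<Inter>\<G> \<Longrightarrow> P u"
    using assms(3) unfolding comeager_def ts by metis
  define V where "V U = {u \<in> ?B. ?w u \<in> ?B \<longrightarrow> ?w u \<in> U}" for U
  have V_open: "openin ?T (V U)" if oU: "openin ?T U" for U
    unfolding op
  proof (intro conjI ballI)
    fix u assume u: "u \<in> V U"
    show "\<exists>n. \<forall>u'\<in>?B. near {..0} n u u' \<longrightarrow> u' \<in> V U"
    proof (cases "?w u \<in> ?B")
      case True
      then have "?w u \<in> U" using u by (auto simp: V_def)
      with oU obtain n where n: "\<forall>v\<in>?B. near {..0} n (?w u) v \<longrightarrow> v \<in> U"
        by (rule openin_sub_seqtopE[OF _ blocks_extensional])
      then show ?thesis using near_append_word[of n u _ k a] by (auto simp: V_def)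
    next
      case False
      \<comment> \<open>If \<open>(u, a)\<close> is not a block, then neither is
        \<open>(u', a)\<close> for \<open>u'\<close> near \<open>u\<close>, since the block space is
        closed.\<close>
      have "openin (seqtop {..0}) (extensional {..0} - ?B)"
        using closedin_blocks[OF assms(1), of "{..0}"] by (simp add: closedin_def)
      then have "openin (subtopology (seqtop {..0}) (extensional {..0})) (extensional {..0} - ?B)"
        using subtopology_topspace[of "seqtop {..0} :: (int \<Rightarrow> 'a) topology"] by simp
      moreover have "?w u \<in> extensional {..0} - ?B" using False w_ext by blast
      ultimately obtain n where n: "\<forall>v\<in>extensional {..0}. near {..0} n (?w u) v \<longrightarrow>
          v \<in> extensional {..0} - ?B"
        by (rule openin_sub_seqtopE[OF _ order_refl])
      then show ?thesis using near_append_word[of n u _ k a] w_ext by (auto simp: V_def)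
    qed
  qed (auto simp: V_def)
  have V_dense: "?T closure_of (V U) = topspace ?T" if "?T closure_of U = topspace ?T" for U
  proof -
    have U: "\<exists>v \<in> U \<inter> ?B. near {..0} n u v" if "u \<in> ?B" for u n
      using that \<open>?T closure_of U = topspace ?T\<close> cl[of u U] ts by auto
    have "\<exists>u' \<in> V U \<inter> ?B. near {..0} n u u'" if u: "u \<in> ?B" for u n
    proof (cases "u \<in> V U")
      case False
      then have "?w u \<in> ?B" using u by (auto simp: V_def)
      \<comment> \<open>The window \<open>n + k\<close> serves two purposes: it forces the last
        \<open>k\<close> letters of \<open>v\<close> to be \<open>a\<close>, and after their removal
        it leaves agreement with \<open>u\<close> on the window \<open>n\<close>.\<close>
      then obtain v where v: "v \<in> U" "v \<in> ?B" "near {..0} (n + k) (?w u) v" using U by blast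
      obtain y where y: "y \<in> X" "v = restrict y {..0}" using v(2) by (auto simp: blocks_def)
      define u' where "u' = restrict (translate (- int k) y) {..0}"
      have nv: "v j = ?w u j" if "j \<le> 0" "\<bar>j\<bar> \<le> int (n + k)" for j
        using v(3) that by (simp add: near_def)
      have wu': "?w u' = v"
      proof
        fix j
        consider "j > 0" | "j \<le> - int k" | "- int k < j" "j \<le> 0" by linarith
        then show "?w u' j = v j"
        proof cases
          case 3
          then have "v j = ?w u j" by (intro nv) auto
          then show ?thesis using 3 assms(2) by (simp add: translate_def append_word_def)
        qed (use assms(2) in \<open>auto simp: translate_def append_word_def u'_def y\<close>)
      qed
      moreover have "u' \<in> ?B"
        using subshift_translate[OF assms(1) y(1)] by (auto simp: u'_def blocks_def)
      moreover have "near {..0} n u u'"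
        unfolding near_def
      proof (intro ballI impI)
        fix j :: int assume j: "j \<in> {..0}" "\<bar>j\<bar> \<le> int n"
        then have "v (j - int k) = ?w u (j - int k)" by (intro nv) auto
        then show "u' j = u j" using j by (simp add: u'_def y translate_def append_word_def)
      qed
      ultimately show ?thesis using v(1) by (intro bexI[of _ u']) (auto simp: V_def)
    next
      case True
      then show ?thesis using u near_refl by blast
    qed
    then show ?thesis unfolding ts by (auto simp: cl)
  qed
  show ?thesis
    unfolding comeager_def ts
  proof (intro exI[of _ "V ` \<G>"] conjI ballI impI)
    show "countable (V ` \<G>)" using \<G>(1) by simp
    fix U assume "U \<in> V ` \<G>"
    then show "openin ?T U" "?T closure_of U = ?B" using \<G>(2) V_open V_dense ts by auto
  next
    fix u assume u: "u \<in> ?B \<inter> \<Inter>(V ` \<G>)" "a \<in> \<Gamma>_plus X 0 k u"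
    then have "?w u \<in> ?B \<inter> \<Inter>\<G>" using \<Gamma>[of u] by (auto simp: V_def)
    then show "P (?w u)" by (rule \<G>(3))
  qed
qed

section \<open>Positivity of \<open>g\<close> and the conditions defining
  \<open>E(g)\<close>\<close>

lemma residual_gfun_continuous:
  assumes "residual_gfun X D g"
  shows "continuous_map (subtopology (seqtop {..0}) D) euclideanreal (\<lambda>u. g u \<sigma>)"
proof -
  have "continuous_map (subtopology (seqtop {..0}) D)
      (prod_topology (subtopology (seqtop {..0}) D) (discrete_topology UNIV)) (\<lambda>u. (u, \<sigma>))"
    by (intro continuous_map_pairedI) auto
  moreover have "continuous_map (prod_topology (subtopology (seqtop {..0}) D) (discrete_topology UNIV))
       euclideanreal (\<lambda>(u, \<sigma>). g u \<sigma>)"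
    using assms by (auto simp: residual_gfun_def continuous_map_in_subtopology)
  ultimately have "continuous_map (subtopology (seqtop {..0}) D) euclideanreal ((\<lambda>(u, \<sigma>). g u \<sigma>) \<circ> (\<lambda>u. (u, \<sigma>)))"
    by (rule continuous_map_compose)
  then show ?thesis by (simp add: o_def)
qed

lemma residual_gfun_subset:
  assumes "residual_gfun X D g"
  shows "D \<subseteq> blocks X {..0}" "D \<subseteq> extensional {..0}"
  using assms by (auto simp: residual_gfun_def residual_in_def)

lemma residual_gfun_nonneg:
  assumes "residual_gfun X D g" "u \<in> D"
  shows "0 \<le> g u \<sigma>"
proof -
  have "(u, \<sigma>) \<in> topspace (prod_topology (subtopology (seqtop {..0}) D) (discrete_topology UNIV))"
    using residual_gfun_subset[OF assms(1)] assms(2) by auto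
  then have "(\<lambda>(u, \<sigma>). g u \<sigma>) (u, \<sigma>) \<in> topspace (top_of_set {0..1})"
    using assms(1) unfolding residual_gfun_def continuous_map_def by blast
  then show ?thesis by simp
qed

lemma residual_gfun_pos_near:
  assumes "residual_gfun X D g" "u \<in> D" "g u \<sigma> > 0"
  shows "\<exists>n. \<forall>v\<in>D. near {..0} n u v \<longrightarrow> g v \<sigma> > 0"
proof -
  let ?S = "{v \<in> topspace (subtopology (seqtop {..0}) D). g v \<sigma> \<in> {0<..}}"
  have "openin (subtopology (seqtop {..0}) D) ?S"
    by (rule openin_continuous_map_preimage[OF residual_gfun_continuous[OF assms(1)]]) simp
  moreover have "u \<in> ?S" using assms(2,3) residual_gfun_subset[OF assms(1)] by auto
  ultimately obtain n where "\<forall>v\<in>D. near {..0} n u v \<longrightarrow> v \<in> ?S"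
    by (rule openin_sub_seqtopE[OF _ residual_gfun_subset(2)[OF assms(1)]])
  then show ?thesis by auto
qed

text \<open>Condition (iii) makes the blocks with positive last transition dense in
  \<open>blocks X {..1}\<close>, property (D) lifts this density to \<open>X\<close>, and continuity
  of \<open>g\<close> makes positivity an open condition.\<close>

lemma comeager_gfun_pos:
  assumes "subshift X" "property_D X" "residual_gfun X D g"
  shows "comeager (subtopology (seqtop UNIV) X)
    (\<lambda>z. restrict z {..0} \<in> D \<longrightarrow> g (restrict z {..0}) (z 1) > 0)"
proof -
  note ts = topspace_sub_seqtop[OF subset_extensional_UNIV, of X]
  note op = openin_sub_seqtop_iff[OF subset_extensional_UNIV, of X]
  note cl = in_closure_sub_seqtop_iff[OF subset_extensional_UNIV, of _ X]
  \<comment> \<open>Positivity is required only at the points of \<open>D\<close> near the past of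
    \<open>z\<close>, not at that past itself, which may lie outside \<open>D\<close>. This is what
    makes \<open>O'\<close> open in \<open>X\<close>.\<close>
  define O' where "O' = {z \<in> X. \<exists>n. \<forall>u\<in>D. near {..0} n z u \<longrightarrow> g u (z 1) > 0}"
  have "openin (subtopology (seqtop UNIV) X) O'"
    unfolding op
  proof (intro conjI ballI)
    fix z assume "z \<in> O'"
    then obtain n where n: "\<forall>u\<in>D. near {..0} n z u \<longrightarrow> g u (z 1) > 0" by (auto simp: O'_def)
    \<comment> \<open>The window \<open>n + 1\<close> includes coordinate 1 even for
      \<open>n = 0\<close>, so the letter \<open>z 1\<close> is preserved.\<close>
    have "z' \<in> O'" if z': "z' \<in> X" "near UNIV (n + 1) z z'" for z'
    proof -
      have "z' 1 = z 1" using z'(2) by (auto simp: near_def)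
      moreover have "near {..0} n z u" if "near {..0} n z' u" for u
        using that z'(2) by (auto simp: near_def)
      ultimately have "\<forall>u\<in>D. near {..0} n z' u \<longrightarrow> g u (z' 1) > 0" using n by auto
      then show ?thesis using z'(1) unfolding O'_def by blast
    qed
    then show "\<exists>n. \<forall>z'\<in>X. near UNIV n z z' \<longrightarrow> z' \<in> O'" by blast
  qed (auto simp: O'_def)
  moreover have "subtopology (seqtop UNIV) X closure_of O' = topspace (subtopology (seqtop UNIV) X)"
  proof -
    have "\<exists>x' \<in> O' \<inter> X. near UNIV n x x'" if x: "x \<in> X" for x n
    proof -
      \<comment> \<open>The projection is taken at 1 rather than 0, because condition (iii) concerns
        the past together with the next letter.\<close>
      obtain y p where y: "y \<in> X" "\<And>y'. y' \<in> X \<Longrightarrow> near {..1} p y y' \<Longrightarrow>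
        \<exists>x'\<in>X. (\<forall>j\<le>1. x' j = y' j) \<and> near UNIV n x x'"
        using property_D_semi_open[OF assms(1,2) x, of 1 n] by blast
      have "restrict y {..1} \<in> blocks X {..1}" using y(1) by (simp add: blocks_def)
      then have "restrict y {..1} \<in> seqtop {..1} closure_of
         {append_word 0 u [\<alpha>] | u \<alpha>. u \<in> D \<and> [\<alpha>] \<in> \<Gamma>_plus X 0 1 u \<and> g u \<alpha> > 0}"
        using assms(3) by (simp add: residual_gfun_def)
      then obtain u \<alpha> where u: "u \<in> D" "[\<alpha>] \<in> \<Gamma>_plus X 0 1 u" "g u \<alpha> > 0"
          "near {..1} p (restrict y {..1}) (append_word 0 u [\<alpha>])"
        unfolding in_closure_seqtop_iff by blast
      obtain y' where y': "y' \<in> X" "append_word 0 u [\<alpha>] = restrict y' {..1}"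
        using u(2) by (auto simp: \<Gamma>_plus_def blocks_def)
      have "near {..1} p y y'" using u(4) unfolding y'(2) by (simp add: near_def)
      then obtain x' where x': "x' \<in> X" "\<forall>j\<le>1. x' j = y' j" "near UNIV n x x'"
        using y(2) y'(1) by blast
      have x'1: "x' 1 = \<alpha>" using fun_cong[OF y'(2), of 1] x'(2) by (simp add: append_word_def)
      have x'0: "x' j = u j" if "j \<le> 0" for j
        using fun_cong[OF y'(2), of j] x'(2) that by (simp add: append_word_def)
      obtain m where "\<forall>v\<in>D. near {..0} m u v \<longrightarrow> g v \<alpha> > 0"
        using residual_gfun_pos_near[OF assms(3) u(1,3)] by blast
      moreover have "near {..0} m u v" if "near {..0} m x' v" for v
        using that x'0 by (auto simp: near_def)
      ultimately have "x' \<in> O'" using x'(1) x'1 unfolding O'_def by blast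
      then show ?thesis using x' by blast
    qed
    then show ?thesis unfolding ts by (auto simp: cl)
  qed
  ultimately show ?thesis
  proof (rule comeager_open_dense)
    fix z assume "z \<in> O'"
    then show "restrict z {..0} \<in> D \<longrightarrow> g (restrict z {..0}) (z 1) > 0"
      unfolding O'_def by (force simp: near_def)
  qed
qed

text \<open>\<open>E(g)\<close> is cut out by one condition for each position and each finite word,
  hence by countably many. Each is a translate of a comeager condition at position 0, and Baire's
  theorem applies in the compact space \<open>X\<close>.\<close>

lemma E_set_dense:
  assumes "subshift X" "property_D X" "residual_gfun X D g" "x \<in> X"
  shows "\<exists>y \<in> E_set X D g. near UNIV n x y"
proof -
  let ?T = "subtopology (seqtop UNIV) X"
  have D: "comeager (subtopology (seqtop {..0}) (blocks X {..0})) (\<lambda>u. u \<in> D)"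
    using assms(3) by (auto simp: residual_gfun_def intro: residual_in_comeager)
  \<comment> \<open>\<open>P\<close> is the clause of \<open>E(g)\<close> on continuations at
    \<open>i = 0\<close>, and \<open>Q\<close> its positivity clause at \<open>i = 0\<close>,
    conditional on the past lying in \<open>D\<close>.\<close>
  define P where "P z a \<longleftrightarrow> (a \<in> \<Gamma>_plus X 0 (length a) (restrict z {..0}) \<longrightarrow>
    translate (int (length a)) (append_word 0 (restrict z {..0}) a) \<in> D)" for z a
  define Q where "Q z \<longleftrightarrow> (restrict z {..0} \<in> D \<longrightarrow> g (restrict z {..0}) (z 1) > 0)" for z
  have "comeager ?T (\<lambda>z. P (translate i z) a)" for i a
    unfolding P_def
    by (rule comeager_translate[OF assms(1) comeager_restrict[OF assms(1,2)
          comeager_append_word[OF assms(1) refl D]]])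
  then have "comeager ?T (\<lambda>z. \<forall>i. \<forall>a. P (translate i z) a)"
    by (intro comeager_countable_all) auto
  moreover have "comeager ?T (\<lambda>z. \<forall>i. Q (translate i z))"
    unfolding Q_def
    by (intro comeager_countable_all comeager_translate[OF assms(1) comeager_gfun_pos[OF assms(1-3)]])
  ultimately have "comeager ?T (\<lambda>z. (\<forall>i. \<forall>a. P (translate i z) a) \<and> (\<forall>i. Q (translate i z)))"
    by (rule comeager_conj)
  then have cm: "comeager ?T (\<lambda>z. z \<in> E_set X D g)"
  proof (rule comeager_mono)
    fix x assume "x \<in> topspace ?T" and PQ: "(\<forall>i. \<forall>a. P (translate i x) a) \<and> (\<forall>i. Q (translate i x))"
    then have x: "x \<in> X" by simp
    have tr: "translate i (restrict x {..i}) = restrict (translate i x) {..0}" for i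
      by (simp add: translate_restrict)
    have C: "append_word i (restrict x {..i}) a \<in> dom_at D (i + int k)"
      if a: "a \<in> \<Gamma>_plus X i k (restrict x {..i})" for i k a
    proof -
      obtain y where y: "y \<in> fiber_word X i x a" and k: "length a = k"
        using a unfolding \<Gamma>_plus_iff by blast
      have yx: "y j = x j" if "j \<le> i" for j
      proof -
        have "restrict y {..i} = restrict x {..i}" using y by (simp add: fiber_word_def fiber_def)
        from fun_cong[OF this, of j] that show ?thesis by simp
      qed
      have "translate i y \<in> fiber_word X 0 (translate i x) a"
        using y subshift_translate[OF assms(1), of y i] yx
        by (auto simp: fiber_word_def fiber_def translate_def restrict_def algebra_simps)
      then have "a \<in> \<Gamma>_plus X 0 (length a) (restrict (translate i x) {..0})"
        unfolding \<Gamma>_plus_iff by blast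
      then have "translate (int k) (append_word 0 (restrict (translate i x) {..0}) a) \<in> D"
        using PQ k unfolding P_def by blast
      then have "translate (int k) (translate i (append_word i (restrict x {..i}) a)) \<in> D"
        unfolding translate_append_word tr .
      then show ?thesis by (simp add: dom_at_def translate_translate add.commute)
    qed
    \<comment> \<open>The empty continuation turns the clause on continuations into membership of
      the past in the domain.\<close>
    have A: "restrict x {..i} \<in> dom_at D i" for i
    proof -
      have "x \<in> fiber_word X i x []" using x by (simp add: fiber_word_def fiber_def)
      then have "[] \<in> \<Gamma>_plus X i 0 (restrict x {..i})" unfolding \<Gamma>_plus_iff by auto
      moreover have "append_word i (restrict x {..i}) [] = restrict x {..i}"
        by (auto simp: append_word_def)
      ultimately show ?thesis using C[of "[]" i 0] by simp
    qed
    have "gfun_at g i (restrict x {..i}) (x (i + 1)) > 0" for i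
    proof -
      have "Q (translate i x)" "restrict (translate i x) {..0} \<in> D"
        using PQ A[of i] by (auto simp: dom_at_def tr)
      then show ?thesis by (simp add: Q_def gfun_at_def tr) (simp add: translate_def add.commute)
    qed
    then show "x \<in> E_set X D g" using x A C by (simp add: E_set_def)
  qed
  have "Hausdorff_space ?T"
    by (intro Hausdorff_space_subtopology Hausdorff_space_seqtop)
  then have "?T closure_of {x \<in> topspace ?T. x \<in> E_set X D g} = topspace ?T"
    by (intro comeager_dense cm subshift_compact assms(1))
  then have "x \<in> ?T closure_of {x \<in> topspace ?T. x \<in> E_set X D g}" using assms(4) by simp
  then show ?thesis
    unfolding in_closure_sub_seqtop_iff[OF subset_extensional_UNIV] by blast
qed

section \<open>Conjugacies and the measures \<open>\<lambda>\<^sub>x\<close>\<close>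

text \<open>The one-sided consequence of a coding window \<open>[-N, N]\<close>. It is stated for
  entire pasts because these are what fibers prescribe.\<close>

definition anticipates :: "nat \<Rightarrow> (int \<Rightarrow> 'a) set \<Rightarrow> ((int \<Rightarrow> 'a) \<Rightarrow> int \<Rightarrow> 'b) \<Rightarrow> bool" where
  "anticipates N X f \<longleftrightarrow>
     (\<forall>x\<in>X. \<forall>y\<in>X. \<forall>i. (\<forall>j\<le>i + int N. y j = x j) \<longrightarrow> (\<forall>j\<le>i. f y j = f x j))"

lemma anticipatesD:
  "anticipates N X f \<Longrightarrow> x \<in> X \<Longrightarrow> y \<in> X \<Longrightarrow> (\<And>j. j \<le> i + int N \<Longrightarrow> y j = x j) \<Longrightarrow> j \<le> i \<Longrightarrow>
    f y j = f x j"
  unfolding anticipates_def by blast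

lemma anticipates_mono: "anticipates N X f \<Longrightarrow> N \<le> M \<Longrightarrow> anticipates M X f"
  unfolding anticipates_def by (meson add_left_mono of_nat_mono order_trans)

lemma translate_equivariant:
  assumes "subshift X" and "\<And>x. x \<in> X \<Longrightarrow> f (shift x) = shift (f x)" and "x \<in> X"
  shows "f (translate i x) = translate i (f x)"
proof -
  have pos: "f (translate (int k) y) = translate (int k) (f y)" if "y \<in> X" for k y
  proof (induction k)
    case 0
    then show ?case by (simp add: translate_def)
  next
    case (Suc k)
    have "f (shift (translate (int k) y)) = shift (f (translate (int k) y))"
      by (intro assms(2) subshift_translate[OF assms(1)] that)
    then show ?case by (simp add: Suc translate_translate)
  qed
  show ?thesis
  proof (cases "i \<ge> 0")
    case True
    then show ?thesis using pos[OF assms(3), of "nat i"] by simp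
  next
    case False
    define k where "k = nat (- i)"
    have i: "i = - int k" using False by (simp add: k_def)
    have "f (translate (int k) (translate (- int k) x)) = translate (int k) (f (translate (- int k) x))"
      by (intro pos subshift_translate[OF assms(1)] assms(3))
    then have "f x = translate (int k) (f (translate (- int k) x))"
      by (simp add: translate_translate)
    then have "translate (- int k) (f x) = f (translate (- int k) x)"
      by (simp add: translate_translate)
    then show ?thesis by (simp add: i)
  qed
qed

text \<open>The argument of Curtis, Hedlund and Lyndon: by continuity a window around
  \<open>x\<close> decides coordinate 0 of the image, by compactness one window serves all
  \<open>x\<close>, and equivariance carries this to every coordinate.\<close>

lemma continuous_equivariant_anticipates:
  fixes X :: "(int \<Rightarrow> 'a::finite) set" and f :: "(int \<Rightarrow> 'a) \<Rightarrow> int \<Rightarrow> 'b"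
  assumes "subshift X" and cont: "continuous_map (subtopology (seqtop UNIV) X) (seqtop UNIV) f"
    and eqv: "\<And>x. x \<in> X \<Longrightarrow> f (shift x) = shift (f x)"
  shows "\<exists>N. anticipates N X f"
proof -
  let ?T = "subtopology (seqtop UNIV) X"
  have "\<exists>n. \<forall>y\<in>X. near UNIV n x y \<longrightarrow> f y 0 = f x 0" if x: "x \<in> X" for x
  proof -
    let ?U = "{y \<in> topspace ?T. f y \<in> {v \<in> extensional UNIV. near UNIV 0 (f x) v}}"
    have "openin ?T ?U"
      by (rule openin_continuous_map_preimage[OF cont openin_cylinder])
    moreover have "x \<in> ?U" using x by simp
    ultimately obtain n where "\<forall>y\<in>X. near UNIV n x y \<longrightarrow> y \<in> ?U"
      by (rule openin_sub_seqtopE[OF _ subset_extensional_UNIV])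
    then show ?thesis by (auto simp: near_def)
  qed
  then obtain n where n: "\<And>x y. x \<in> X \<Longrightarrow> y \<in> X \<Longrightarrow> near UNIV (n x) x y \<Longrightarrow> f y 0 = f x 0"
    by metis
  define C where "C x = {y \<in> X. near UNIV (n x) x y}" for x
  have "openin ?T (C x)" for x
    unfolding C_def openin_sub_seqtop_iff[OF subset_extensional_UNIV] by (auto intro: near_trans)
  then have op: "openin ?T U" if "U \<in> C ` X" for U using that by auto
  have "topspace ?T \<subseteq> \<Union>(C ` X)" by (auto simp: C_def)
  with subshift_compact[OF assms(1)] op
  have "\<exists>\<F>. finite \<F> \<and> \<F> \<subseteq> C ` X \<and> topspace ?T \<subseteq> \<Union>\<F>"
    unfolding compact_space_alt by (elim allE[of _ "C ` X"] mp) blast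
  then obtain \<F> where \<F>: "finite \<F>" "\<F> \<subseteq> C ` X" "X \<subseteq> \<Union>\<F>" by auto
  obtain F where F: "finite F" "F \<subseteq> X" "X \<subseteq> \<Union>(C ` F)"
    using finite_subset_image[OF \<F>(1,2)] \<F>(3) by metis
  \<comment> \<open>The inserted 0 keeps the maximum meaningful when \<open>F\<close> is
    empty.\<close>
  define N where "N = Max (insert 0 (n ` F))"
  have N: "n z \<le> N" if "z \<in> F" for z unfolding N_def using F(1) that by (intro Max_ge) auto
  have zero: "f y 0 = f x 0" if xy: "x \<in> X" "y \<in> X" "near UNIV N x y" for x y
  proof -
    obtain z where z: "z \<in> F" "x \<in> C z" using F(3) xy(1) by blast
    have "near UNIV (n z) z x" using z by (simp add: C_def)
    moreover have "near UNIV (n z) x y" using near_mono[OF xy(3) N[OF z(1)]] .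
    ultimately have "near UNIV (n z) z y" by (rule near_trans)
    then show ?thesis using n[of z x] n[of z y] z xy F(2) by (auto simp: C_def)
  qed
  have "anticipates N X f"
    unfolding anticipates_def
  proof (intro ballI allI impI)
    fix x y i j assume x: "x \<in> X" and y: "y \<in> X" and xy: "\<forall>j\<le>i + int N. y j = x j" and j: "j \<le> (i::int)"
    have "near UNIV N (translate j x) (translate j y)"
      using xy j by (auto simp: near_def translate_def)
    then have "f (translate j y) 0 = f (translate j x) 0"
      by (intro zero subshift_translate[OF assms(1)] x y)
    then show "f y j = f x j"
      by (simp add: translate_equivariant[where f = f, OF assms(1) eqv] x y) (simp add: translate_def)
  qed
  then show ?thesis ..
qed

text \<open>This makes the situation symmetric in the two subshifts. The inverse is taken as
  \<open>inv_into X \<phi>\<close>, the form in which \<open>gfun_image\<close> uses it.\<close>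

lemma topological_conjugacy_inv:
  assumes "subshift X" "topological_conjugacy X X' \<phi>"
  shows "topological_conjugacy X' X (inv_into X \<phi>)" and "bij_betw \<phi> X X'"
proof -
  let ?T = "subtopology (seqtop UNIV) X" and ?T' = "subtopology (seqtop UNIV) X'"
  note ts = topspace_sub_seqtop[OF subset_extensional_UNIV]
  have hm: "homeomorphic_map ?T ?T' \<phi>" and eqv: "\<And>x. x \<in> X \<Longrightarrow> \<phi> (shift x) = shift (\<phi> x)"
    using assms(2) by (auto simp: topological_conjugacy_def)
  have inj: "inj_on \<phi> X" and im: "\<phi> ` X = X'"
    using homeomorphic_imp_injective_map[OF hm] homeomorphic_imp_surjective_map[OF hm] ts by auto
  then show "bij_betw \<phi> X X'" by (simp add: bij_betw_def)
  obtain h where h: "homeomorphic_maps ?T ?T' \<phi> h" using hm by (auto simp: homeomorphic_map_maps)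
  then have "homeomorphic_map ?T' ?T h"
    using homeomorphic_maps_sym homeomorphic_maps_map by blast
  moreover have "h y = inv_into X \<phi> y" if "y \<in> topspace ?T'" for y
  proof -
    have "h y \<in> X" "\<phi> (h y) = y"
      using h that ts by (auto simp: homeomorphic_maps_def continuous_map_def)
    then show ?thesis using inv_into_f_f[OF inj, of "h y"] by simp
  qed
  ultimately have "homeomorphic_map ?T' ?T (inv_into X \<phi>)"
    by (rule homeomorphic_map_eq)
  moreover have "inv_into X \<phi> (shift y) = shift (inv_into X \<phi> y)" if "y \<in> X'" for y
  proof -
    obtain x where x: "x \<in> X" "y = \<phi> x" using im \<open>y \<in> X'\<close> by blast
    have "inv_into X \<phi> (\<phi> (shift x)) = shift x"
      by (intro inv_into_f_f[OF inj] subshift_translate[OF assms(1)] x)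
    then show ?thesis using x eqv inv_into_f_f[OF inj x(1)] by simp
  qed
  ultimately show "topological_conjugacy X' X (inv_into X \<phi>)"
    by (simp add: topological_conjugacy_def)
qed

lemma topological_conjugacy_anticipates:
  assumes "subshift X" "topological_conjugacy X X' \<phi>"
  shows "\<exists>N. anticipates N X \<phi>"
proof (rule continuous_equivariant_anticipates[OF assms(1)])
  have "continuous_map (subtopology (seqtop UNIV) X) (subtopology (seqtop UNIV) X') \<phi>"
    using assms(2) by (auto simp: topological_conjugacy_def intro: homeomorphic_imp_continuous_map)
  then show "continuous_map (subtopology (seqtop UNIV) X) (seqtop UNIV) \<phi>"
    by (simp add: continuous_map_in_subtopology)
qed (use assms(2) in \<open>auto simp: topological_conjugacy_def\<close>)

section \<open>Borel sets and the spaces carrying the measures\<close>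

lemma space_borel_in [simp]: "space (borel_in T) = topspace T"
  by (simp add: borel_in_def space_measure_of_conv)

lemma sets_borel_in: "sets (borel_in T) = sigma_sets (topspace T) {U. openin T U}"
  unfolding borel_in_def by (rule sets_measure_of) (auto dest: openin_subset)

lemma borel_in_closed:
  assumes "closedin T C"
  shows "C \<in> sets (borel_in T)"
proof -
  have "topspace T - C \<in> sets (borel_in T)"
    using assms by (auto simp: sets_borel_in closedin_def)
  then have "space (borel_in T) - (topspace T - C) \<in> sets (borel_in T)" by (rule sets.compl_sets)
  then show ?thesis using closedin_subset[OF assms] by (simp add: double_diff)
qed

lemma measurable_borel_in:
  assumes "continuous_map S T f"
  shows "f \<in> measurable (borel_in S) (borel_in T)"
  unfolding borel_in_def[of T]
proof (rule measurable_measure_of)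
  show "{U. openin T U} \<subseteq> Pow (topspace T)" by (auto dest: openin_subset)
  show "f \<in> space (borel_in S) \<rightarrow> topspace T"
    using assms by (auto simp: continuous_map_def)
  fix U assume "U \<in> {U. openin T U}"
  then have "openin S {x \<in> topspace S. f x \<in> U}"
    using openin_continuous_map_preimage[OF assms] by simp
  moreover have "f -` U \<inter> space (borel_in S) = {x \<in> topspace S. f x \<in> U}" by auto
  ultimately show "f -` U \<inter> space (borel_in S) \<in> sets (borel_in S)" by (simp add: sets_borel_in)
qed

text \<open>The points left asymptotic to \<open>x\<close>, that is, equal to it in the far past:
  the underlying space of the measures in \<open>is_lambda\<close>.\<close>

definition leaf :: "(int \<Rightarrow> 'a) set \<Rightarrow> (int \<Rightarrow> 'a) \<Rightarrow> (int \<Rightarrow> 'a) set" where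
  "leaf X x = (\<Union>k::nat. fiber X (- int k) x)"

lemma fiber_iff: "y \<in> fiber X i x \<longleftrightarrow> y \<in> X \<and> (\<forall>j\<le>i. y j = x j)"
  by (auto simp: fiber_def restrict_def fun_eq_iff)

lemma fiber_word_iff:
  "y \<in> fiber_word X i x a \<longleftrightarrow> y \<in> X \<and> (\<forall>j\<le>i. y j = x j) \<and> (\<forall>j<length a. y (i + 1 + int j) = a ! j)"
  by (auto simp: fiber_word_def fiber_iff)

lemma fiber_eq_fiber_word: "fiber X i x = fiber_word X i x []"
  by (simp add: fiber_word_def)

lemma fiber_word_subset_leaf: "fiber_word X i x a \<subseteq> leaf X x"
proof
  fix y assume "y \<in> fiber_word X i x a"
  then have "y \<in> fiber X (- int (nat \<bar>i\<bar>)) x" by (auto simp: fiber_word_iff fiber_iff)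
  then show "y \<in> leaf X x" unfolding leaf_def by blast
qed

lemma leaf_subset: "leaf X x \<subseteq> X"
  by (auto simp: leaf_def fiber_iff)

text \<open>Agreement up to \<open>-k\<close> gives agreement of the images up to
  \<open>-(k + N)\<close>. Hence a conjugacy matches leaves, and measures on corresponding leaves
  can be compared.\<close>

lemma anticipates_leaf:
  assumes "anticipates N X f" "\<And>x. x \<in> X \<Longrightarrow> f x \<in> X'" "x \<in> X" "y \<in> leaf X x"
  shows "f y \<in> leaf X' (f x)"
proof -
  obtain k where k: "y \<in> X" "\<forall>j\<le>- int k. y j = x j"
    using assms(4) by (auto simp: leaf_def fiber_iff)
  have "f y j = f x j" if "j \<le> - int (k + N)" for j
    by (rule anticipatesD[OF assms(1,3) k(1) _ that]) (use k(2) in auto)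
  then have "f y \<in> fiber X' (- int (k + N)) (f x)" using assms(2)[OF k(1)] by (simp add: fiber_iff)
  then show ?thesis unfolding leaf_def by blast
qed

lemma is_lambda_sets: "is_lambda X g x L \<Longrightarrow> sets L = sets (borel_in (subtopology (seqtop UNIV) (leaf X x)))"
  by (simp add: is_lambda_def leaf_def)

lemma is_lambda_space: "is_lambda X g x L \<Longrightarrow> space L = leaf X x"
  using sets_eq_imp_space_eq[OF is_lambda_sets] by simp

text \<open>A point outside violates the prescription at a single coordinate, so the set is closed
  in the leaf. It need not be open, since infinitely many coordinates are prescribed.\<close>

lemma fiber_word_in_sets:
  assumes "is_lambda X g x L"
  shows "fiber_word X i x a \<in> sets L"
proof -
  have "openin (subtopology (seqtop UNIV) (leaf X x)) (leaf X x - fiber_word X i x a)"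
    unfolding openin_sub_seqtop_iff[OF subset_extensional_UNIV]
  proof (intro conjI ballI)
    fix y assume y: "y \<in> leaf X x - fiber_word X i x a"
    then have yX: "y \<in> X" using leaf_subset by blast
    have "\<exists>k. \<forall>y'. y' k = y k \<longrightarrow> y' \<notin> fiber_word X i x a"
    proof (cases "\<forall>j\<le>i. y j = x j")
      case True
      then obtain j where "j < length a" "y (i + 1 + int j) \<noteq> a ! j"
        using y yX by (auto simp: fiber_word_iff)
      then show ?thesis by (intro exI[of _ "i + 1 + int j"]) (auto simp: fiber_word_iff)
    next
      case False
      then obtain j where "j \<le> i" "y j \<noteq> x j" by blast
      then show ?thesis by (intro exI[of _ j]) (auto simp: fiber_word_iff)
    qed
    then obtain k where k: "\<And>y'. y' k = y k \<Longrightarrow> y' \<notin> fiber_word X i x a" by blast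
    have "y' k = y k" if "near UNIV (nat \<bar>k\<bar>) y y'" for y' using that by (auto simp: near_def)
    then show "\<exists>n. \<forall>y'\<in>leaf X x. near UNIV n y y' \<longrightarrow> y' \<in> leaf X x - fiber_word X i x a"
      using k by blast
  qed auto
  then have "closedin (subtopology (seqtop UNIV) (leaf X x)) (fiber_word X i x a)"
    using fiber_word_subset_leaf[of X i x a] by (simp add: closedin_def)
  then show ?thesis unfolding is_lambda_sets[OF assms] by (rule borel_in_closed)
qed

section \<open>The values that measures of cylinders can take\<close>

text \<open>The possible measures of cylinders of length \<open>n\<close> relative to their fiber; 0
  is added for words that cannot continue the past and so have an empty cylinder.\<close>

definition products :: "real set \<Rightarrow> nat \<Rightarrow> real set" where
  "products R n = insert 0 ((\<lambda>r. \<Prod>k<n. r k) ` (PiE {..<n} (\<lambda>_. R)))"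

lemma finite_products: "finite R \<Longrightarrow> finite (products R n)"
  by (simp add: products_def finite_PiE)

text \<open>The product formula holds for the normalized restriction to the fiber; the normalization
  is undone by the measure of the fiber, which is positive and finite.\<close>

lemma lambda_fiber_word:
  assumes "is_lambda X g x L" "a \<in> \<Gamma>_plus X i n (restrict x {..i})"
  shows "emeasure L (fiber_word X i x a) = emeasure L (fiber X i x) *
    ennreal (\<Prod>k<n. gfun_at g (i + int k) (append_word i (restrict x {..i}) (take k a)) (a ! k))"
    (is "_ = ?e * ennreal ?p")
proof -
  have F: "0 < ?e" "?e < \<infinity>" "is_mu X g i x (scale_measure (inverse ?e) (restrict_space L (fiber X i x)))"
    using assms(1) by (auto simp: is_lambda_def)
  have fs: "fiber X i x \<in> sets L" unfolding fiber_eq_fiber_word by (rule fiber_word_in_sets[OF assms(1)])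
  have "emeasure (scale_measure (inverse ?e) (restrict_space L (fiber X i x))) (fiber_word X i x a) = ennreal ?p"
    using F(3) assms(2) unfolding is_mu_def by blast
  moreover have "emeasure (restrict_space L (fiber X i x)) (fiber_word X i x a) =
      emeasure L (fiber_word X i x a)"
    by (rule emeasure_restrict_space) (use fs in \<open>auto simp: fiber_word_def\<close>)
  ultimately have "inverse ?e * emeasure L (fiber_word X i x a) = ennreal ?p" by simp
  then have "?e * ennreal ?p = (?e / ?e) * emeasure L (fiber_word X i x a)"
    by (simp add: divide_ennreal_def mult.assoc)
  also have "?e / ?e = 1" using F by (intro ennreal_divide_self) auto
  finally show ?thesis by (simp only: mult_1_left)
qed

text \<open>A prefix of a continuation is a continuation, witnessed by the same point. By the
  definition of \<open>E_set\<close> the past extended by the prefix lies in the domain, so every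
  factor is a genuine value of \<open>g\<close>.\<close>

lemma lambda_fiber_word_products:
  assumes "residual_gfun X D g" "x \<in> E_set X D g" "is_lambda X g x L" "length a = n"
  shows "\<exists>p\<in>products (gfun_range D g) n. 0 \<le> p \<and>
    emeasure L (fiber_word X i x a) = emeasure L (fiber X i x) * ennreal p"
proof (cases "a \<in> \<Gamma>_plus X i n (restrict x {..i})")
  case True
  define r where "r k = gfun_at g (i + int k) (append_word i (restrict x {..i}) (take k a)) (a ! k)" for k
  have r: "r k \<in> gfun_range D g \<and> 0 \<le> r k" if "k < n" for k
  proof -
    obtain y where "y \<in> fiber_word X i x a" using True unfolding \<Gamma>_plus_iff by blast
    then have "y \<in> fiber_word X i x (take k a)" by (auto simp: fiber_word_iff)
    then have "take k a \<in> \<Gamma>_plus X i k (restrict x {..i})"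
      unfolding \<Gamma>_plus_iff using that assms(4) by auto
    then have "append_word i (restrict x {..i}) (take k a) \<in> dom_at D (i + int k)"
      using assms(2) unfolding E_set_def by blast
    then show ?thesis
      using residual_gfun_nonneg[OF assms(1)]
      unfolding r_def gfun_at_def dom_at_def gfun_range_def by blast
  qed
  have "(\<Prod>k<n. r k) = (\<Prod>k<n. restrict r {..<n} k)" by simp
  moreover have "restrict r {..<n} \<in> PiE {..<n} (\<lambda>_. gfun_range D g)" using r by auto
  ultimately have "(\<Prod>k<n. r k) \<in> products (gfun_range D g) n" unfolding products_def by blast
  moreover have "0 \<le> (\<Prod>k<n. r k)" using r by (intro prod_nonneg) auto
  ultimately show ?thesis using lambda_fiber_word[OF assms(3) True] unfolding r_def by blast
next
  case False
  then have "fiber_word X i x a = {}" using assms(4) by (simp add: \<Gamma>_plus_iff)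
  then show ?thesis by (intro bexI[of _ 0]) (auto simp: products_def)
qed

text \<open>The type argument records the alphabet, which a set of reals cannot show. The set of
  words is arbitrary and the summands are chosen independently, so that only \<open>V\<close>,
  \<open>n\<close> and the alphabet bound the possibilities.\<close>

definition word_sums :: "'a::finite itself \<Rightarrow> real set \<Rightarrow> nat \<Rightarrow> real set" where
  "word_sums _ V n = (\<Union>A \<in> Pow {a::'a list. length a = n}. (\<lambda>p. \<Sum>a\<in>A. p a) ` (PiE A (\<lambda>_. V)))"

lemma finite_words: "finite {a::'a::finite list. length a = n}"
  using finite_lists_length_eq[of "UNIV :: 'a set" n] by simp

lemma finite_word_sums: "finite V \<Longrightarrow> finite (word_sums TYPE('a::finite) V n)"
  unfolding word_sums_def
  by (intro finite_UN_I finite_imageI finite_PiE)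
     (auto intro: finite_subset[OF _ finite_words] simp: finite_words)

text \<open>A part of the fiber decided by the next \<open>n\<close> letters is the disjoint union
  of the cylinders of length \<open>n\<close> that it contains. The set of possible values of
  \<open>s\<close> depends neither on \<open>x\<close> nor on \<open>i\<close> nor on
  \<open>B\<close>.\<close>

lemma lambda_saturated:
  fixes X :: "(int \<Rightarrow> 'a::finite) set"
  assumes "residual_gfun X D g" "x \<in> E_set X D g" "is_lambda X g x L"
    and B: "B \<subseteq> fiber X i x"
    and sat: "\<And>y z. y \<in> B \<Longrightarrow> z \<in> X \<Longrightarrow> (\<And>j. j \<le> i + int n \<Longrightarrow> z j = y j) \<Longrightarrow> z \<in> B"
  shows "\<exists>s\<in>word_sums TYPE('a) (products (gfun_range D g) n) n. 0 \<le> s \<and>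
    emeasure L B = emeasure L (fiber X i x) * ennreal s"
proof -
  let ?F = "fiber_word X i x"
  define A where "A = {a. length a = n \<and> ?F a \<subseteq> B}"
  have A: "A \<subseteq> {a. length a = n}" by (auto simp: A_def)
  have finA: "finite A" by (rule finite_subset[OF A finite_words])
  have "y \<in> (\<Union>a\<in>A. ?F a)" if y: "y \<in> B" for y
  proof -
    \<comment> \<open>The word that \<open>y\<close> shows on \<open>i + 1\<close> to
      \<open>i + n\<close>; saturation puts its whole cylinder into \<open>B\<close>.\<close>
    define a where "a = map (\<lambda>j. y (i + 1 + int j)) [0..<n]"
    have "?F a \<subseteq> B"
    proof
      fix z assume z: "z \<in> ?F a"
      have "z j = y j" if "j \<le> i + int n" for j
      proof (cases "j \<le> i")
        case True
        then show ?thesis using z y B by (auto simp: fiber_word_iff fiber_iff)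
      next
        case False
        define k where "k = nat (j - i - 1)"
        have "j = i + 1 + int k" "k < n" using False that by (auto simp: k_def)
        then show ?thesis using z by (auto simp: fiber_word_iff a_def)
      qed
      then show "z \<in> B" using sat[OF y, of z] z by (auto simp: fiber_word_iff)
    qed
    moreover have "y \<in> ?F a" using y B by (auto simp: fiber_word_iff fiber_iff a_def)
    moreover have "length a = n" by (simp add: a_def)
    ultimately show ?thesis unfolding A_def by blast
  qed
  then have BU: "B = (\<Union>a\<in>A. ?F a)" by (auto simp: A_def)
  have dis: "disjoint_family_on ?F A"
    unfolding disjoint_family_on_def
  proof (intro ballI impI)
    fix a b assume ab: "a \<in> A" "b \<in> A" "a \<noteq> b"
    then obtain j where "j < n" "a ! j \<noteq> b ! j" using nth_equalityI[of a b] by (auto simp: A_def)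
    then show "?F a \<inter> ?F b = {}" using ab by (auto simp: fiber_word_iff A_def)
  qed
  have "\<exists>p\<in>products (gfun_range D g) n. 0 \<le> p \<and> emeasure L (?F a) = emeasure L (fiber X i x) * ennreal p"
    if "a \<in> A" for a
    using that A by (intro lambda_fiber_word_products[OF assms(1-3)]) auto
  then obtain p where p: "\<And>a. a \<in> A \<Longrightarrow> p a \<in> products (gfun_range D g) n \<and> 0 \<le> p a \<and>
      emeasure L (?F a) = emeasure L (fiber X i x) * ennreal (p a)"
    by metis
  have "emeasure L B = (\<Sum>a\<in>A. emeasure L (?F a))"
    unfolding BU using dis finA fiber_word_in_sets[OF assms(3)]
    by (intro sum_emeasure[symmetric]) auto
  also have "\<dots> = (\<Sum>a\<in>A. emeasure L (fiber X i x) * ennreal (p a))" using p by simp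
  also have "\<dots> = emeasure L (fiber X i x) * ennreal (\<Sum>a\<in>A. p a)"
    using p by (simp add: sum_distrib_left[symmetric] sum_ennreal)
  finally have "emeasure L B = emeasure L (fiber X i x) * ennreal (\<Sum>a\<in>A. p a)" .
  moreover have "(\<Sum>a\<in>A. p a) = (\<Sum>a\<in>A. restrict p A a)" by simp
  then have "(\<Sum>a\<in>A. p a) \<in> word_sums TYPE('a) (products (gfun_range D g) n) n"
    unfolding word_sums_def using A p by (intro UN_I[of A] image_eqI[of _ _ "restrict p A"]) auto
  moreover have "0 \<le> (\<Sum>a\<in>A. p a)" using p by (intro sum_nonneg) auto
  ultimately show ?thesis by blast
qed

section \<open>Comparing the ranges\<close>

text \<open>A finite set is closed, so a value outside \<open>Q\<close> would persist on a
  neighbourhood in \<open>D\<close>, and by density this contains the past of a point of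
  \<open>E(g)\<close>.\<close>

lemma residual_gfun_values_on_E_set:
  assumes "subshift X" "property_D X" "residual_gfun X D g" "finite Q"
    and Q: "\<And>y \<sigma>. y \<in> E_set X D g \<Longrightarrow> g (restrict y {..0}) \<sigma> \<in> Q"
  shows "finite (gfun_range D g)"
proof (rule finite_subset[OF _ assms(4)])
  note DS = residual_gfun_subset[OF assms(3)]
  have "g u \<sigma> \<in> Q" if u: "u \<in> D" for u \<sigma>
  proof (rule ccontr)
    assume nQ: "g u \<sigma> \<notin> Q"
    let ?S = "{v \<in> topspace (subtopology (seqtop {..0}) D). g v \<sigma> \<in> - Q}"
    have "openin euclideanreal (- Q)" using finite_imp_closed[OF assms(4)] by auto
    then have "openin (subtopology (seqtop {..0}) D) ?S"
      by (rule openin_continuous_map_preimage[OF residual_gfun_continuous[OF assms(3)]])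
    moreover have "u \<in> ?S" using u DS nQ by auto
    ultimately obtain n where n: "\<forall>v\<in>D. near {..0} n u v \<longrightarrow> v \<in> ?S"
      by (rule openin_sub_seqtopE[OF _ DS(2)])
    obtain x where x: "x \<in> X" "u = restrict x {..0}" using u DS(1) by (auto simp: blocks_def)
    obtain y where y: "y \<in> E_set X D g" "near UNIV n x y"
      using E_set_dense[OF assms(1-3) x(1)] by blast
    have "restrict y {..0} \<in> dom_at D 0" using y(1) by (simp add: E_set_def)
    then have "restrict y {..0} \<in> D" by (simp add: dom_at_def)
    moreover have "near {..0} n u (restrict y {..0})" using y(2) x(2) by (auto simp: near_def)
    ultimately have "restrict y {..0} \<in> ?S" using n by blast
    then show False using Q[OF y(1)] by auto
  qed
  then show "gfun_range D g \<subseteq> Q" by (auto simp: gfun_range_def)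
qed

text \<open>Stated for an abstract pair of maps and an unspecified factor \<open>c\<close>, so that
  it serves both directions. Numerator and denominator of a value of \<open>g'\<close> are pulled
  back to the same fiber over \<open>x\<close>, where \<open>c\<close> and the measure of that fiber
  cancel.\<close>

lemma gfun_range_finite_transfer:
  fixes X D :: "(int \<Rightarrow> 'a::finite) set" and X' D' :: "(int \<Rightarrow> 'b::finite) set"
  assumes "subshift X'" "property_D X'" "residual_gfun X D g" "residual_gfun X' D' g'"
    and \<phi>: "anticipates N X \<phi>" and \<psi>: "anticipates N X' \<psi>" and inv: "\<And>x. x \<in> X \<Longrightarrow> \<psi> (\<phi> x) = x"
    and \<phi>X: "\<And>x. x \<in> X \<Longrightarrow> \<phi> x \<in> X'"
    and im: "\<And>y. y \<in> E_set X' D' g' \<Longrightarrow> \<exists>x\<in>E_set X D g. \<exists>L L' c. \<phi> x = y \<and>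
      is_lambda X g x L \<and> is_lambda X' g' y L' \<and> 0 < c \<and>
      (\<forall>i a. emeasure L' (fiber_word X' i y a) = ennreal c * emeasure L {z \<in> X. \<phi> z \<in> fiber_word X' i y a})"
    and "finite (gfun_range D g)"
  shows "finite (gfun_range D' g')"
proof -
  \<comment> \<open>Letters of the image up to coordinate 1 depend on coordinates up to
    \<open>N + 1\<close>, and the fiber starts at \<open>-N\<close>, so \<open>2 * N + 1\<close>
    further letters decide.\<close>
  define n where "n = 2 * N + 1"
  define W where "W = word_sums TYPE('a) (products (gfun_range D g) n) n"
  have "finite W" unfolding W_def by (intro finite_word_sums finite_products assms)
  \<comment> \<open>The 0 accounts for letters that cannot follow the given past.\<close>
  define Q where "Q = insert 0 ((\<lambda>(s, t). s / t) ` (W \<times> W))"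
  have "finite Q" using \<open>finite W\<close> by (simp add: Q_def)
  moreover have "g' (restrict y {..0}) \<sigma> \<in> Q" if y: "y \<in> E_set X' D' g'" for y \<sigma>
  proof -
    let ?u = "restrict y {..0}"
    have "?u \<in> dom_at D' 0" using y by (simp add: E_set_def)
    then have u: "?u \<in> D'" by (simp add: dom_at_def)
    have yX: "y \<in> X'" using y by (simp add: E_set_def)
    show ?thesis
    proof (cases "[\<sigma>] \<in> \<Gamma>_plus X' 0 1 ?u")
      case False
      then have "g' ?u \<sigma> = 0" using u assms(4) unfolding residual_gfun_def by blast
      then show ?thesis by (simp add: Q_def)
    next
      case True
      obtain x L L' c where x: "x \<in> E_set X D g" "\<phi> x = y" and L: "is_lambda X g x L"
        and L': "is_lambda X' g' y L'" and c: "0 < c"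
        and im_eq: "\<forall>i a. emeasure L' (fiber_word X' i y a) =
          ennreal c * emeasure L {z \<in> X. \<phi> z \<in> fiber_word X' i y a}"
        using im[OF y] by (elim bexE exE conjE) (rule that)
      have xX: "x \<in> X" using x(1) by (simp add: E_set_def)
      let ?B = "\<lambda>a. {z \<in> X. \<phi> z \<in> fiber_word X' 0 y a}"
      let ?F = "emeasure L (fiber X (- int N) x)"
      \<comment> \<open>The empty word gives the denominator and \<open>[\<sigma>]\<close> the
        numerator; treating both over one fiber with one \<open>n\<close> makes the quotient
        independent of \<open>?F\<close>.\<close>
      have sum: "\<exists>s\<in>W. 0 \<le> s \<and> emeasure L (?B a) = ?F * ennreal s" if a: "length a \<le> 1" for a
        unfolding W_def
      proof (rule lambda_saturated[OF assms(3) x(1) L])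
        show "?B a \<subseteq> fiber X (- int N) x"
        proof
          fix z assume z: "z \<in> ?B a"
          then have zX: "z \<in> X" "\<phi> z \<in> X'" "\<forall>j\<le>0. \<phi> z j = y j" by (auto simp: fiber_word_iff)
          \<comment> \<open>Agreement of the images up to 0 is carried back by \<open>\<psi>\<close>
            at the cost of \<open>N\<close> coordinates.\<close>
          have "\<psi> (\<phi> z) j = \<psi> y j" if "j \<le> - int N" for j
            by (rule anticipatesD[OF \<psi> yX zX(2) _ that]) (use zX(3) in auto)
          then show "z \<in> fiber X (- int N) x"
            using inv[OF zX(1)] inv[OF xX] x(2) zX(1) by (simp add: fiber_iff)
        qed
      next
        fix z z' assume z: "z \<in> ?B a" "z' \<in> X" "\<And>j. j \<le> - int N + int n \<Longrightarrow> z' j = z j"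
        have eq: "\<phi> z' j = \<phi> z j" if "j \<le> 1" for j
          by (rule anticipatesD[OF \<phi> _ z(2) _ that]) (use z in \<open>auto simp: n_def\<close>)
        have "\<phi> z' \<in> X'" by (rule \<phi>X[OF z(2)])
        then show "z' \<in> ?B a" using z(1,2) eq a by (auto simp: fiber_word_iff)
      qed
      obtain s where s: "s \<in> W" "0 \<le> s" "emeasure L (?B []) = ?F * ennreal s"
        using sum[of "[]"] by auto
      obtain t where t: "t \<in> W" "0 \<le> t" "emeasure L (?B [\<sigma>]) = ?F * ennreal t"
        using sum[of "[\<sigma>]"] by auto
      let ?F' = "emeasure L' (fiber X' 0 y)"
      have F: "0 < ?F" "?F < \<infinity>" and F': "0 < ?F'" "?F' < \<infinity>"
        using L L' by (auto simp: is_lambda_def)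
      have "append_word 0 ?u [] = ?u" by (auto simp: append_word_def)
      then have "emeasure L' (fiber_word X' 0 y [\<sigma>]) = ?F' * ennreal (g' ?u \<sigma>)"
        using lambda_fiber_word[OF L' True] by (simp add: gfun_at_def)
      then have eq: "ennreal c * (?F * ennreal t) = ennreal c * (?F * ennreal s) * ennreal (g' ?u \<sigma>)"
        using im_eq[rule_format, of 0 "[\<sigma>]"] im_eq[rule_format, of 0 "[]"] s(3) t(3) by (simp add: fiber_eq_fiber_word)
      \<comment> \<open>The fiber has positive finite measure, so the equation can be moved to the
        reals and its common factors cancelled.\<close>
      obtain f where f: "?F = ennreal f" "0 < f" using F by (cases ?F) auto
      have g0: "0 \<le> g' ?u \<sigma>" by (rule residual_gfun_nonneg[OF assms(4) u])
      have "ennreal (c * (f * t)) = ennreal (c * (f * s) * g' ?u \<sigma>)"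
        using eq c f s(2) t(2) g0 by (simp add: ennreal_mult[symmetric])
      then have "c * (f * t) = c * (f * s) * g' ?u \<sigma>"
        using c f s(2) t(2) g0 by (subst (asm) ennreal_inj) auto
      then have "t = s * g' ?u \<sigma>" using c f by simp
      \<comment> \<open>The denominator does not vanish because the fiber of \<open>y\<close> has
        positive measure.\<close>
      moreover have "s \<noteq> 0"
      proof
        assume "s = 0"
        then have "?F' = 0" using im_eq[rule_format, of 0 "[]"] s(3) by (simp add: fiber_eq_fiber_word)
        then show False using F' by simp
      qed
      ultimately have "g' ?u \<sigma> = t / s" by simp
      then show ?thesis using s(1) t(1) by (auto simp: Q_def)
    qed
  qed
  ultimately show ?thesis by (rule residual_gfun_values_on_E_set[OF assms(1,2,4)])
qed

text \<open>Between leaves the map is continuous, hence Borel. For \<open>\<psi>\<close> this lets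
  \<open>distr\<close> be evaluated on sets; for \<open>\<phi>\<close> it makes preimages of
  cylinders measurable.\<close>

lemma measurable_leaf:
  assumes "continuous_map (subtopology (seqtop UNIV) X) (subtopology (seqtop UNIV) X') f"
    and "anticipates N X f" "x \<in> X" "is_lambda X g x L" "is_lambda X' g' (f x) L'"
  shows "f \<in> measurable L L'"
proof -
  have fX: "f z \<in> X'" if "z \<in> X" for z
    using assms(1) that by (auto simp: continuous_map_def)
  have "continuous_map (subtopology (seqtop UNIV) (leaf X x)) (subtopology (seqtop UNIV) (leaf X' (f x))) f"
    using assms(1) anticipates_leaf[OF assms(2) fX assms(3)] leaf_subset[of X x]
    by (auto simp: continuous_map_in_subtopology intro: continuous_map_from_subtopology_mono)
  then have "f \<in> measurable (borel_in (subtopology (seqtop UNIV) (leaf X x)))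
      (borel_in (subtopology (seqtop UNIV) (leaf X' (f x))))"
    by (rule measurable_borel_in)
  then show ?thesis
    by (simp add: measurable_cong_sets[OF is_lambda_sets[OF assms(4)] is_lambda_sets[OF assms(5)]])
qed

theorem theorem3p3:
  fixes X D :: "(int \<Rightarrow> 'a::finite) set" and g :: "(int \<Rightarrow> 'a) \<Rightarrow> 'a \<Rightarrow> real"
    and X' D' :: "(int \<Rightarrow> 'b::finite) set" and g' :: "(int \<Rightarrow> 'b) \<Rightarrow> 'b \<Rightarrow> real"
    and \<phi> :: "(int \<Rightarrow> 'a) \<Rightarrow> int \<Rightarrow> 'b"
  assumes "subshift X" and "property_D X"
    and "subshift X'" and "property_D X'"
    and "residual_gfun X D g"
    and "residual_gfun X' D' g'"
    and "topological_conjugacy X X' \<phi>"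
    and "gfun_image X D g \<phi> X' D' g'"
  shows "finite (gfun_range D g) \<longleftrightarrow> finite (gfun_range D' g')"
proof -
  define \<psi> where "\<psi> = inv_into X \<phi>"
  note \<psi>_conj = topological_conjugacy_inv(1)[OF assms(1,7), folded \<psi>_def]
  have bij: "bij_betw \<phi> X X'" by (rule topological_conjugacy_inv(2)[OF assms(1,7)])
  have \<phi>X: "\<phi> x \<in> X'" and \<psi>\<phi>: "\<psi> (\<phi> x) = x" if "x \<in> X" for x
    using bij that by (auto simp: \<psi>_def bij_betw_def)
  have \<psi>X: "\<psi> y \<in> X" and \<phi>\<psi>: "\<phi> (\<psi> y) = y" if "y \<in> X'" for y
    using bij that by (auto simp: \<psi>_def bij_betw_def inv_into_into f_inv_into_f)
  obtain N1 N2 where "anticipates N1 X \<phi>" "anticipates N2 X' \<psi>"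
    using topological_conjugacy_anticipates[OF assms(1,7)]
      topological_conjugacy_anticipates[OF assms(3) \<psi>_conj] by blast
  then obtain N where N: "anticipates N X \<phi>" "anticipates N X' \<psi>"
    using anticipates_mono[of N1 X \<phi> "max N1 N2"] anticipates_mono[of N2 X' \<psi> "max N1 N2"] by simp
  have \<phi>_cont: "continuous_map (subtopology (seqtop UNIV) X) (subtopology (seqtop UNIV) X') \<phi>"
    and \<psi>_cont: "continuous_map (subtopology (seqtop UNIV) X') (subtopology (seqtop UNIV) X) \<psi>"
    using assms(7) \<psi>_conj by (auto simp: topological_conjugacy_def homeomorphic_imp_continuous_map)
  have E_im: "\<phi> ` E_set X D g = E_set X' D' g'" using assms(8) by (simp add: gfun_image_def)
  \<comment> \<open>Both formulas come from the single equation for \<open>distr\<close>: cylinders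
    over \<open>\<phi> x\<close> are pulled back by \<open>\<phi>\<close>, those over
    \<open>x\<close> by \<open>\<psi>\<close> with the reciprocal factor.\<close>
  have image: "\<exists>L L' c. is_lambda X g x L \<and> is_lambda X' g' (\<phi> x) L' \<and> 0 < c \<and>
      (\<forall>i a. emeasure L' (fiber_word X' i (\<phi> x) a) =
         ennreal c * emeasure L {z \<in> X. \<phi> z \<in> fiber_word X' i (\<phi> x) a}) \<and>
      (\<forall>i a. emeasure L (fiber_word X i x a) =
         ennreal (1 / c) * emeasure L' {z \<in> X'. \<psi> z \<in> fiber_word X i x a})"
    if x: "x \<in> E_set X D g" for x
  proof -
    have xX: "x \<in> X" using x by (simp add: E_set_def)
    obtain L L' c where L: "is_lambda X g x L" and L': "is_lambda X' g' (\<phi> x) L'" and c: "0 < c"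
      and d: "distr L' L \<psi> = scale_measure (ennreal c) L"
      using x assms(8) unfolding gfun_image_def \<psi>_def by blast
    have sp: "space L = leaf X x" "space L' = leaf X' (\<phi> x)"
      using is_lambda_space[OF L] is_lambda_space[OF L'] by auto
    have \<phi>_meas: "\<phi> \<in> measurable L L'" by (rule measurable_leaf[OF \<phi>_cont N(1) xX L L'])
    have \<psi>_meas: "\<psi> \<in> measurable L' L"
      using measurable_leaf[OF \<psi>_cont N(2) \<phi>X[OF xX] L', of g L] L \<psi>\<phi>[OF xX] by simp
    have \<psi>_leaf: "\<psi> z \<in> leaf X x" if "z \<in> leaf X' (\<phi> x)" for z
      using anticipates_leaf[OF N(2) \<psi>X \<phi>X[OF xX] that] \<psi>\<phi>[OF xX] by simp
    have \<phi>_leaf: "\<phi> z \<in> leaf X' (\<phi> x)" if "z \<in> leaf X x" for z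
      using anticipates_leaf[OF N(1) \<phi>X xX that] by simp
    have key: "emeasure L' (\<psi> -` A \<inter> space L') = ennreal c * emeasure L A" if "A \<in> sets L" for A
    proof -
      have "emeasure L' (\<psi> -` A \<inter> space L') = emeasure (distr L' L \<psi>) A"
        by (rule emeasure_distr[OF \<psi>_meas that, symmetric])
      then show ?thesis by (simp add: d)
    qed
    have "emeasure L' (fiber_word X' i (\<phi> x) a) =
         ennreal c * emeasure L {z \<in> X. \<phi> z \<in> fiber_word X' i (\<phi> x) a}" for i a
    proof -
      let ?B = "fiber_word X' i (\<phi> x) a" and ?A = "{z \<in> X. \<phi> z \<in> fiber_word X' i (\<phi> x) a}"
      have "?B \<subseteq> leaf X' (\<phi> x)" by (rule fiber_word_subset_leaf)
      then have "?A = \<phi> -` ?B \<inter> space L"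
        using \<psi>_leaf \<psi>\<phi> leaf_subset[of X x] unfolding sp by force
      then have "?A \<in> sets L"
        using measurable_sets[OF \<phi>_meas fiber_word_in_sets[OF L']] by simp
      \<comment> \<open>On the leaf \<open>\<psi>\<close> undoes \<open>\<phi>\<close>, so pulling
        the set back twice returns the original cylinder.\<close>
      moreover have "\<psi> -` ?A \<inter> space L' = ?B"
        using \<open>?B \<subseteq> leaf X' (\<phi> x)\<close> leaf_subset[of X' "\<phi> x"] \<phi>\<psi> \<psi>X unfolding sp by force
      ultimately show ?thesis using key[of ?A] by simp
    qed
    moreover have "emeasure L (fiber_word X i x a) =
         ennreal (1 / c) * emeasure L' {z \<in> X'. \<psi> z \<in> fiber_word X i x a}" for i a
    proof -
      let ?A = "fiber_word X i x a"
      have "?A \<subseteq> leaf X x" by (rule fiber_word_subset_leaf)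
      then have "\<psi> -` ?A \<inter> space L' = {z \<in> X'. \<psi> z \<in> ?A}"
        using \<phi>_leaf \<phi>\<psi> leaf_subset[of X' "\<phi> x"] unfolding sp by force
      then have "emeasure L' {z \<in> X'. \<psi> z \<in> ?A} = ennreal c * emeasure L ?A"
        using key[OF fiber_word_in_sets[OF L], of i a] by simp
      then show ?thesis using c by (simp add: mult.assoc[symmetric] ennreal_mult[symmetric])
    qed
    ultimately show ?thesis using L L' c by (intro exI conjI allI)
  qed
  show ?thesis
  proof
    assume fin: "finite (gfun_range D g)"
    show "finite (gfun_range D' g')"
    proof (rule gfun_range_finite_transfer[OF assms(3,4,5,6) N \<psi>\<phi> \<phi>X _ fin])
      fix y assume "y \<in> E_set X' D' g'"
      then obtain x where x: "x \<in> E_set X D g" "y = \<phi> x" using E_im by blast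
      then show "\<exists>x\<in>E_set X D g. \<exists>L L' c. \<phi> x = y \<and>
        is_lambda X g x L \<and> is_lambda X' g' y L' \<and> 0 < c \<and>
        (\<forall>i a. emeasure L' (fiber_word X' i y a) =
          ennreal c * emeasure L {z \<in> X. \<phi> z \<in> fiber_word X' i y a})"
        using image[OF x(1)] unfolding x(2)
        by (elim exE conjE, intro bexI[OF _ x(1)] exI conjI refl)
    qed
  next
    assume fin: "finite (gfun_range D' g')"
    show "finite (gfun_range D g)"
    \<comment> \<open>The same transfer with the two subshifts exchanged; \<open>\<phi> x\<close> is
      the point of the other system that \<open>\<psi>\<close> sends to \<open>x\<close>.\<close>
    proof (rule gfun_range_finite_transfer[OF assms(1,2,6,5) N(2,1) \<phi>\<psi> \<psi>X _ fin])
      fix x assume x: "x \<in> E_set X D g"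
      have xX: "x \<in> X" using x by (simp add: E_set_def)
      obtain L L' c where "is_lambda X g x L" "is_lambda X' g' (\<phi> x) L'" "0 < c"
        "\<forall>i a. emeasure L (fiber_word X i x a) =
         ennreal (1 / c) * emeasure L' {z \<in> X'. \<psi> z \<in> fiber_word X i x a}"
        using image[OF x] by (elim exE conjE) (rule that)
      moreover have "\<phi> x \<in> E_set X' D' g'" using x E_im by blast
      moreover have "0 < 1 / c" using \<open>0 < c\<close> by simp
      ultimately show "\<exists>y\<in>E_set X' D' g'. \<exists>L' L c. \<psi> y = x \<and>
        is_lambda X' g' y L' \<and> is_lambda X g x L \<and> 0 < c \<and>
        (\<forall>i a. emeasure L (fiber_word X i x a) =
          ennreal c * emeasure L' {z \<in> X'. \<psi> z \<in> fiber_word X i x a})"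
        using \<psi>\<phi>[OF xX] by (intro bexI[of _ "\<phi> x"] exI conjI)
    qed
  qed
qed

end
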